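(* Let $M\subset\mathbb{R}^D$ be a compact submanifold with reach $\tau_M>0$. Then at least one of the following two assertions holds. (Global case) $M$ has a bottleneck $(q_1,q_2)\in M^2$, that is, there exist $z_0\in Med(M)$ and $q_1,q_2\in M$ such that $q_1,q_2\in\partial\mathcal{B}(z_0,\tau_M)$ and $\|q_1-q_2\|=2\tau_M$. (Local case) There exist $q_0\in M$ and an arc-length parametrized geodesic $\gamma_0$ of $M$ such that $\gamma_0(0)=q_0$ and $\|\gamma_0''(0)\|=\frac{1}{\tau_M}$.
   Context: $D\ge 2$ and $\mathbb{R}^D$ carries the Euclidean norm $\|\cdot\|$; $\mathcal{B}(x,r)$ is the closed ball of center $x$ and radius $r$. Submanifolds of $\mathbb{R}^D$ are embedded, compact, connected, without boundary, of dimension $1\le d<D$, and of class at least $\mathcal{C}^2$. For closed $A\subset\mathbb{R}^D$, $d(z,A)=\inf_{p\in A}\|p-z\|$, the medial axis is $Med(A)=\{z\in\mathbb{R}^D : \exists\, p\ne q\in A,\ \|p-z\|=\|q-z\|=d(z,A)\}$, and the reach is $\tau_A=\inf_{z\in Med(A)}d(z,A)$. Geodesics of $M$ are those of the metric induced by $\mathbb{R}^D$, and $\gamma''$ denotes the second derivative of $\gamma$ as a curve in $\mathbb{R}^D$. *)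

theory Defs
  imports "HOL-Analysis.Analysis"
begin

definition C2_on :: "('a::euclidean_space \<Rightarrow> 'b::euclidean_space) \<Rightarrow> 'a set \<Rightarrow> bool" where
  "C2_on f U \<longleftrightarrow>
     (\<exists>(f' :: 'a \<Rightarrow> 'a \<Rightarrow>\<^sub>L 'b) (f'' :: 'a \<Rightarrow> 'a \<Rightarrow>\<^sub>L 'a \<Rightarrow>\<^sub>L 'b).
        (\<forall>x\<in>U. (f has_derivative blinfun_apply (f' x)) (at x)) \<and>
        (\<forall>x\<in>U. (f' has_derivative blinfun_apply (f'' x)) (at x)) \<and>
        continuous_on U f'')"

text \<open>Embedded submanifold without boundary, of dimension d and class at least C2: around each
  of its points the set is straightened onto a d-dimensional linear subspace by a
  C2-diffeomorphism between open subsets of the ambient space. The empty set is excluded.\<close>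

definition C2_submanifold :: "nat \<Rightarrow> 'a::euclidean_space set \<Rightarrow> bool" where
  "C2_submanifold d M \<longleftrightarrow> M \<noteq> {} \<and>
     (\<forall>p\<in>M. \<exists>U (V :: 'a set) \<phi> \<psi> S. open U \<and> p \<in> U \<and> open V \<and>
        homeomorphism U V \<phi> \<psi> \<and> C2_on \<phi> U \<and> C2_on \<psi> V \<and>
        subspace S \<and> dim S = d \<and> \<phi> ` (U \<inter> M) = V \<inter> S)"

definition medial_axis :: "'a::euclidean_space set \<Rightarrow> 'a set" where
  "medial_axis A =
     {z. \<exists>p\<in>A. \<exists>q\<in>A. p \<noteq> q \<and> norm (p - z) = infdist z A \<and> norm (q - z) = infdist z A}"

text \<open>Extended real, so that the infimum over an empty medial axis is infinite.\<close>

definition reach :: "'a::euclidean_space set \<Rightarrow> ereal" where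
  "reach A = (INF z\<in>medial_axis A. ereal (infdist z A))"

definition bottleneck :: "'a::euclidean_space set \<Rightarrow> 'a \<Rightarrow> 'a \<Rightarrow> bool" where
  "bottleneck M q1 q2 \<longleftrightarrow> q1 \<in> M \<and> q2 \<in> M \<and>
     (\<exists>z0\<in>medial_axis M.
        q1 \<in> frontier (cball z0 (real_of_ereal (reach M))) \<and>
        q2 \<in> frontier (cball z0 (real_of_ereal (reach M))) \<and>
        norm (q1 - q2) = 2 * real_of_ereal (reach M))"

definition tangent_space :: "'a::euclidean_space set \<Rightarrow> 'a \<Rightarrow> 'a set" where
  "tangent_space M p =
     {v. \<exists>c e. e > 0 \<and> c ` {-e<..<e} \<subseteq> M \<and> c 0 = p \<and> (c has_vector_derivative v) (at (0::real))}"

definition velocity :: "(real \<Rightarrow> 'a::euclidean_space) \<Rightarrow> real \<Rightarrow> 'a" where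
  "velocity \<gamma> t = vector_derivative \<gamma> (at t)"

definition acceleration :: "(real \<Rightarrow> 'a::euclidean_space) \<Rightarrow> real \<Rightarrow> 'a" where
  "acceleration \<gamma> t = vector_derivative (velocity \<gamma>) (at t)"

text \<open>The Levi-Civita connection of the metric induced on M by the ambient Euclidean space is the
  tangential part of the Euclidean derivative; the nearest point of the linear subspace
  \<^term>\<open>tangent_space M (\<gamma> t)\<close> is the orthogonal projection onto it.\<close>

definition covariant_acceleration ::
    "'a::euclidean_space set \<Rightarrow> (real \<Rightarrow> 'a) \<Rightarrow> real \<Rightarrow> 'a" where
  "covariant_acceleration M \<gamma> t = closest_point (tangent_space M (\<gamma> t)) (acceleration \<gamma> t)"

definition arclength_geodesic ::
    "'a::euclidean_space set \<Rightarrow> real set \<Rightarrow> (real \<Rightarrow> 'a) \<Rightarrow> bool" where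
  "arclength_geodesic M I \<gamma> \<longleftrightarrow>
     open I \<and> is_interval I \<and> \<gamma> ` I \<subseteq> M \<and>
     (\<forall>t\<in>I. \<gamma> differentiable (at t)) \<and>
     (\<forall>t\<in>I. velocity \<gamma> differentiable (at t)) \<and>
     continuous_on I (acceleration \<gamma>) \<and>
     (\<forall>t\<in>I. covariant_acceleration M \<gamma> t = 0) \<and>
     (\<forall>t\<in>I. norm (velocity \<gamma> t) = 1)"

end

theory Submission
  imports Defs "HOL-Complex_Analysis.Great_Picard"
begin

text \<open>
  Let \<open>r\<close> be the reach. The key tool is Federer's inequality (\<open>nearest_point_inner_le\<close>): if \<open>p\<close> is the
  nearest point of \<open>M\<close> to \<open>p + s n\<close> for one \<open>s > 0\<close>, with \<open>n\<close> a unit vector, then the open ball of radius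
  \<open>r\<close> around \<open>p + r n\<close> misses \<open>M\<close>. Within the reach nearest points are unique and hence depend
  continuously on the point, and Brouwer's fixed point theorem pushes \<open>p + s n\<close> away from \<open>p\<close> while
  keeping \<open>p\<close> nearest (\<open>nearest_point_extend\<close>). Applied at the end points of a diameter of \<open>M\<close>,
  the inequality shows that the reach is finite (\<open>reach_finite\<close>).

  Now choose points \<open>z\<^sub>n\<close> of the medial axis whose distances to \<open>M\<close> tend to \<open>r\<close>, with two distinct
  nearest points \<open>p\<^sub>n\<close> and \<open>q\<^sub>n\<close> each, converging to \<open>z\<^sub>0\<close>, \<open>p\<^sub>0\<close> and \<open>q\<^sub>0\<close>.

  If \<open>p\<^sub>0 \<noteq> q\<^sub>0\<close>, then both lie on the sphere of radius \<open>r\<close> around \<open>z\<^sub>0\<close>, whose interior misses \<open>M\<close>. Antipodal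
  points form a bottleneck. Otherwise Federer's inequality at the point of \<open>M\<close> nearest to the chord midpoint
  leaves only one position for that point, namely the midpoint of the shorter great circle arc from \<open>p\<^sub>0\<close> to
  \<open>q\<^sub>0\<close> (\<open>arc_midpoint_mem\<close>). Iterating and closing up, \<open>M\<close> contains the whole arc. Its
  acceleration has norm \<open>1 / r\<close> and points to \<open>z\<^sub>0\<close>, which is normal to \<open>M\<close> because \<open>z\<^sub>0\<close> has
  the points of the arc as nearest points. So the arc is the required geodesic, and no comparison of
  lengths of curves enters.

  If \<open>p\<^sub>0 = q\<^sub>0\<close>, a second-order expansion of the identity \<open>2 (q\<^sub>n - p\<^sub>n) \<bullet> (z\<^sub>n - p\<^sub>n) = \<parallel>q\<^sub>n - p\<^sub>n\<parallel>\<^sup>2\<close> in a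
  chart yields a tangent direction at \<open>p\<^sub>0\<close> in which the second fundamental form, tested against
  \<open>z\<^sub>0 - p\<^sub>0\<close>, equals \<open>1\<close> (\<open>merging_nearest_points\<close>). The geodesic in this direction therefore
  has acceleration of norm at least \<open>1 / r\<close>, and Federer's inequality in the direction of the acceleration
  gives at most \<open>1 / r\<close> (\<open>acceleration_inner_le\<close>). For \<open>M\<close> of class \<open>C\<^sup>2\<close> the geodesic equation
  has merely continuous coefficients, so the geodesic comes from Peano's existence theorem.
\<close>

section \<open>Nearest points and the reach\<close>

definition nearest_points :: "'a::euclidean_space set \<Rightarrow> 'a \<Rightarrow> 'a set" where
  "nearest_points A z = {p\<in>A. norm (p - z) = infdist z A}"

lemma nearest_points_iff:
  "p \<in> nearest_points A z \<longleftrightarrow> p \<in> A \<and> (\<forall>q\<in>A. norm (p - z) \<le> norm (q - z))"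
proof
  assume "p \<in> nearest_points A z"
  then show "p \<in> A \<and> (\<forall>q\<in>A. norm (p - z) \<le> norm (q - z))"
    unfolding nearest_points_def using infdist_le[of _ A z] by (auto simp: dist_norm norm_minus_commute)
next
  assume p: "p \<in> A \<and> (\<forall>q\<in>A. norm (p - z) \<le> norm (q - z))"
  then have "infdist z A \<le> norm (p - z)"
    using infdist_le[of p A z] by (simp add: dist_norm norm_minus_commute)
  moreover have "norm (p - z) \<le> infdist z A"
    unfolding infdist_def using p
    by (auto intro!: cINF_greatest simp: dist_norm norm_minus_commute)
  ultimately show "p \<in> nearest_points A z"
    using p unfolding nearest_points_def by auto
qed

lemma nearest_points_nonempty:
  assumes "closed A" "A \<noteq> {}"
  obtains p where "p \<in> nearest_points A z"
proof -
  obtain p where "p \<in> A" "infdist z A = dist z p"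
    using infdist_attains_inf[OF assms] by blast
  then show thesis
    using that[of p] by (simp add: nearest_points_def dist_norm norm_minus_commute)
qed

lemma nearest_point_unique:
  assumes "ereal (infdist z A) < reach A" "p \<in> nearest_points A z" "q \<in> nearest_points A z"
  shows "p = q"
proof (rule ccontr)
  assume "p \<noteq> q"
  then have "z \<in> medial_axis A"
    using assms(2,3) unfolding medial_axis_def nearest_points_def by auto
  then have "reach A \<le> ereal (infdist z A)"
    unfolding reach_def by (rule INF_lower)
  with assms(1) show False by simp
qed

text \<open>A limit of nearest points is a nearest point, so the graph of a nearest-point map is closed;
  into a compact set this is continuity.\<close>

lemma continuous_on_nearest_point:
  fixes A K :: "'a::euclidean_space set"
  assumes "compact A" "closed K"
    and near: "\<And>y. y \<in> K \<Longrightarrow> \<pi> y \<in> nearest_points A y"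
    and uniq: "\<And>y p. y \<in> K \<Longrightarrow> p \<in> nearest_points A y \<Longrightarrow> p = \<pi> y"
  shows "continuous_on K \<pi>"
proof (rule continuous_from_closed_graph[OF \<open>compact A\<close>])
  show "\<pi> \<in> K \<rightarrow> A"
    using near by (auto simp: nearest_points_def)
  have eq: "(\<lambda>y. (y, \<pi> y)) ` K =
      (K \<times> A) \<inter> {w. norm (snd w - fst w) = infdist (fst w) A}"
    using near uniq unfolding nearest_points_def by (auto simp: image_iff)
  have "closed {w. norm (snd w - fst w) = infdist (fst w) A}"
    by (intro closed_Collect_eq continuous_intros)
  then show "closed ((\<lambda>y. (y, \<pi> y)) ` K)"
    unfolding eq using assms compact_imp_closed by (intro closed_Int closed_Times) auto
qed

text \<open>Inside the reach, a nearest point stays nearest when one moves away from it. The map sending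
  \<open>y\<close> to the point at distance \<open>e\<close> from \<open>x\<close> opposite to the nearest point of \<open>y\<close> has a fixed point
  by Brouwer's theorem, and a fixed point has a nearest point of \<open>x\<close> as its own nearest point.\<close>

lemma nearest_point_extend:
  fixes A :: "'a::euclidean_space set"
  assumes A: "compact A" and p: "p \<in> nearest_points A x" and "p \<noteq> x" and e: "0 < e"
    and reach: "ereal (infdist x A + e) < reach A"
  shows "p \<in> nearest_points A (x + (e / norm (x - p)) *\<^sub>R (x - p))"
proof -
  have ne: "A \<noteq> {}" and clo: "closed A"
    using p A compact_imp_closed by (auto simp: nearest_points_def)
  have small: "ereal (infdist y A) < reach A" if "y \<in> cball x e" for y
  proof -
    have "infdist y A \<le> infdist x A + e"
      using infdist_triangle[of y A x] that by (simp add: dist_commute)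
    then show ?thesis using reach by (meson ereal_less_eq(3) le_less_trans)
  qed
  have x_notin: "x \<notin> A"
    using p \<open>p \<noteq> x\<close> by (auto simp: nearest_points_def)
  have "\<forall>y. \<exists>p. p \<in> nearest_points A y"
    using nearest_points_nonempty[OF clo ne] by blast
  then obtain \<pi> where \<pi>: "\<And>y. \<pi> y \<in> nearest_points A y"
    by metis
  then have \<pi>A: "\<pi> y \<in> A" for y by (auto simp: nearest_points_def)
  have cont: "continuous_on (cball x e) \<pi>"
    using nearest_point_unique[OF small] \<pi>
    by (intro continuous_on_nearest_point[OF A closed_cball]) blast+
  define f where "f = (\<lambda>y. x + (e / norm (x - \<pi> y)) *\<^sub>R (x - \<pi> y))"
  have nz: "norm (x - \<pi> y) \<noteq> 0" for y
    using \<pi>A[of y] x_notin by auto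
  have "continuous_on (cball x e) f"
    unfolding f_def using nz by (intro continuous_intros cont) auto
  moreover have "f \<in> cball x e \<rightarrow> cball x e"
    using nz e by (auto simp: f_def dist_norm)
  ultimately obtain y where y: "y \<in> cball x e" "f y = y"
    using brouwer_ball[OF e] by blast
  define b where "b = norm (x - \<pi> y)"
  have b: "b > 0" using nz[of y] by (simp add: b_def)
  have yx: "y - x = (e / b) *\<^sub>R (x - \<pi> y)"
    using y(2) by (simp add: f_def b_def algebra_simps)
  have "y - \<pi> y = (1 + e / b) *\<^sub>R (x - \<pi> y)"
    using yx by (simp add: algebra_simps)
  then have "norm (y - \<pi> y) = \<bar>1 + e / b\<bar> * norm (x - \<pi> y)"
    by simp
  also have "\<dots> = (1 + e / b) * b"
    using b e unfolding b_def[symmetric] by simp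
  also have "\<dots> = b + e"
    using b by (simp add: field_simps)
  finally have far: "norm (y - \<pi> y) = b + e" .
  have nyx: "norm (y - x) = e"
    using yx e b by (simp add: b_def)
  have "\<pi> y \<in> nearest_points A x"
    unfolding nearest_points_iff
  proof (intro conjI ballI)
    fix q assume "q \<in> A"
    then have "norm (\<pi> y - y) \<le> norm (q - y)"
      using \<pi>[of y] by (simp add: nearest_points_iff)
    moreover have "norm (q - y) \<le> norm (q - x) + norm (y - x)"
      using norm_triangle_ineq4[of "q - x" "y - x"] by simp
    ultimately show "norm (\<pi> y - x) \<le> norm (q - x)"
      using far nyx by (simp add: b_def norm_minus_commute)
  qed (rule \<pi>A)
  moreover have "ereal (infdist x A) < reach A"
    by (rule small) (use e in simp)
  ultimately have "\<pi> y = p"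
    using nearest_point_unique p by blast
  then show ?thesis
    using \<pi>[of y] y(2) by (simp add: f_def)
qed

text \<open>Federer's inequality: if \<open>p\<close> is nearest at some positive distance in the unit direction \<open>n\<close>, then it
  stays nearest at all distances below the reach, so no point of \<open>A\<close> lies in the open ball of radius \<open>r\<close> that is
  tangent at \<open>p\<close> and centred in direction \<open>n\<close>.\<close>

lemma nearest_point_inner_le:
  fixes A :: "'a::euclidean_space set"
  assumes A: "compact A" and p: "p \<in> nearest_points A (p + s *\<^sub>R n)" and s: "0 < s"
    and n: "norm n = 1" and r: "0 \<le> r" "ereal r \<le> reach A" and q: "q \<in> A"
  shows "2 * r * ((q - p) \<bullet> n) \<le> (norm (q - p))\<^sup>2"
proof -
  have ball: "2 * t * ((q - p) \<bullet> n) \<le> (norm (q - p))\<^sup>2"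
    if "p \<in> nearest_points A (p + t *\<^sub>R n)" "0 \<le> t" for t
  proof -
    have "norm (p - (p + t *\<^sub>R n)) \<le> norm (q - (p + t *\<^sub>R n))"
      using that q by (simp add: nearest_points_iff)
    then have "t \<le> norm ((q - p) - t *\<^sub>R n)"
      using that n by (simp add: algebra_simps)
    then have "t\<^sup>2 \<le> (norm ((q - p) - t *\<^sub>R n))\<^sup>2"
      using that by (intro power_mono) auto
    also have "\<dots> = (norm (q - p))\<^sup>2 - 2 * t * ((q - p) \<bullet> n) + t\<^sup>2 * (n \<bullet> n)"
      unfolding power2_norm_eq_inner
      by (simp add: inner_diff_left inner_diff_right inner_commute power2_eq_square algebra_simps)
    finally show ?thesis using n by (simp add: dot_square_norm)
  qed
  have below: "2 * t * ((q - p) \<bullet> n) \<le> (norm (q - p))\<^sup>2" if t: "s \<le> t" "t < r" for t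
  proof (cases "t = s")
    case True
    then show ?thesis using ball[of s] p s by simp
  next
    case False
    have eq: "norm (p - (p + s *\<^sub>R n)) = s" using n s by simp
    have inf: "infdist (p + s *\<^sub>R n) A = s"
      using p eq by (simp add: nearest_points_def)
    have "ereal (infdist (p + s *\<^sub>R n) A + (t - s)) < reach A"
      using inf t r by (simp add: less_le_trans[of "ereal t" "ereal r"])
    moreover have "p \<noteq> p + s *\<^sub>R n" using n s by auto
    ultimately have "p \<in> nearest_points A
        (p + s *\<^sub>R n + ((t - s) / norm (p + s *\<^sub>R n - p)) *\<^sub>R (p + s *\<^sub>R n - p))"
      using False t by (intro nearest_point_extend[OF A p]) auto
    also have "p + s *\<^sub>R n + ((t - s) / norm (p + s *\<^sub>R n - p)) *\<^sub>R (p + s *\<^sub>R n - p) = p + t *\<^sub>R n"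
      using s n by (simp flip: scaleR_left.add add: add.assoc)
    finally show ?thesis using ball t s by simp
  qed
  show ?thesis
  proof (cases "(q - p) \<bullet> n \<le> 0")
    case True
    then have "2 * r * ((q - p) \<bullet> n) \<le> 0"
      using r by (simp add: mult_nonneg_nonpos)
    then show ?thesis by (meson order_trans zero_le_power2)
  next
    case False
    show ?thesis
    proof (cases "r \<le> s")
      case True
      then have "2 * r * ((q - p) \<bullet> n) \<le> 2 * s * ((q - p) \<bullet> n)"
        using False by simp
      then show ?thesis using ball[of s] p s by linarith
    next
      case rs: False
      show ?thesis
      proof (rule dense_le)
        fix w assume w: "w < 2 * r * ((q - p) \<bullet> n)"
        define t where "t = max s (w / (2 * ((q - p) \<bullet> n)))"
        have "w / (2 * ((q - p) \<bullet> n)) < r"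
          using w False by (simp add: divide_less_eq mult_ac)
        then have "t < r" using rs by (simp add: t_def)
        moreover have "w \<le> 2 * t * ((q - p) \<bullet> n)"
        proof -
          have "w / (2 * ((q - p) \<bullet> n)) \<le> t" by (simp add: t_def)
          then show ?thesis using False by (simp add: divide_le_eq mult_ac)
        qed
        ultimately show "w \<le> (norm (q - p))\<^sup>2"
          using below[of t] by (force simp: t_def)
      qed
    qed
  qed
qed

section \<open>Chords shorter than a diameter produce circular arcs\<close>

text \<open>Let \<open>y\<close> be nearest to the chord midpoint \<open>m\<close>. The ball of radius \<open>r\<close> tangent at \<open>y\<close> on the side
  of \<open>m\<close> contains neither \<open>p\<close> nor \<open>q\<close>, which by the parallelogram law bounds the distance from \<open>m\<close>
  to \<open>y\<close> by the distance from \<open>m\<close> to the sphere around \<open>z\<close>. Since \<open>A\<close> avoids the open ball around \<open>z\<close>, the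
  point \<open>y\<close> can only be the point of the sphere closest to \<open>m\<close>.\<close>

lemma arc_midpoint_mem:
  fixes A :: "'a::euclidean_space set"
  assumes A: "compact A" and pq: "p \<in> A" "q \<in> A" and r: "0 < r" "ereal r \<le> reach A"
    and sphere: "norm (p - z) = r" "norm (q - z) = r"
    and avoid: "\<And>a. a \<in> A \<Longrightarrow> r \<le> norm (a - z)"
    and e: "norm e = 1" and k: "0 < k" and mid: "midpoint p q - z = k *\<^sub>R e"
  shows "z + r *\<^sub>R e \<in> A"
proof -
  define m where "m = midpoint p q"
  define l where "l = norm (p - q) / 2"
  have mz: "m = z + k *\<^sub>R e" using mid by (simp add: m_def algebra_simps)
  have par: "(norm (p - c))\<^sup>2 + (norm (q - c))\<^sup>2 = 2 * (norm (m - c))\<^sup>2 + 2 * l\<^sup>2" for c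
  proof -
    have 1: "p - c = (m - c) + (1/2) *\<^sub>R (p - q)" "q - c = (m - c) - (1/2) *\<^sub>R (p - q)"
      by (simp_all add: m_def midpoint_def algebra_simps flip: scaleR_left.add)
    have 2: "l\<^sup>2 = (norm ((1/2) *\<^sub>R (p - q)))\<^sup>2"
      by (simp add: l_def)
    show ?thesis
      unfolding 1 2 power2_norm_eq_inner
      by (simp add: inner_add_left inner_add_right inner_diff_left inner_diff_right inner_commute
          algebra_simps)
  qed
  have kl: "r\<^sup>2 = k\<^sup>2 + l\<^sup>2"
    using par[of z] sphere e by (simp add: mz)
  have "k\<^sup>2 \<le> r\<^sup>2" "l\<^sup>2 < r\<^sup>2" using kl k by auto
  then have kr: "k \<le> r" "l < r"
    using r k by (auto simp: power2_le_iff_abs_le power_less_imp_less_base intro: power2_le_imp_le)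
  obtain y where y: "y \<in> nearest_points A m"
    using nearest_points_nonempty[of A m] A pq compact_imp_closed by auto
  then have yA: "y \<in> A" by (simp add: nearest_points_def)
  define \<delta> where "\<delta> = norm (m - y)"
  have "norm (y - m) \<le> norm (p - m)"
    using y pq by (simp add: nearest_points_iff)
  also have "norm (p - m) = l"
    using dist_midpoint(1)[of p q] by (simp add: m_def l_def dist_norm)
  finally have \<delta>l: "\<delta> \<le> l" by (simp add: \<delta>_def norm_minus_commute)
  have close: "\<delta> \<le> r - k"
  proof (cases "\<delta> = 0")
    case True
    then show ?thesis using kr by simp
  next
    case False
    then have \<delta>: "\<delta> > 0" by (simp add: \<delta>_def)
    define n where "n = (1 / \<delta>) *\<^sub>R (m - y)"
    have n: "norm n = 1" using \<delta> by (simp add: n_def \<delta>_def)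
    have m: "m = y + \<delta> *\<^sub>R n" using \<delta> by (simp add: n_def)
    define c where "c = y + r *\<^sub>R n"
    have out: "r\<^sup>2 \<le> (norm (a - c))\<^sup>2" if "a \<in> A" for a
    proof -
      have "2 * r * ((a - y) \<bullet> n) \<le> (norm (a - y))\<^sup>2"
        using y r that by (intro nearest_point_inner_le[OF A _ \<delta> n]) (auto simp: m[symmetric])
      moreover have "(norm (a - c))\<^sup>2 = (norm (a - y))\<^sup>2 - 2 * r * ((a - y) \<bullet> n) + r\<^sup>2 * (n \<bullet> n)"
      proof -
        have ac: "a - c = (a - y) - r *\<^sub>R n" by (simp add: c_def)
        show ?thesis
          unfolding ac power2_norm_eq_inner
          by (simp add: inner_diff_left inner_diff_right inner_commute power2_eq_square algebra_simps)
      qed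
      ultimately show ?thesis using n by (simp add: dot_square_norm)
    qed
    have "m - c = (\<delta> - r) *\<^sub>R n" by (simp add: m c_def algebra_simps)
    then have "(norm (m - c))\<^sup>2 = (r - \<delta>)\<^sup>2" using n by (simp add: power2_commute)
    then have "k\<^sup>2 \<le> (r - \<delta>)\<^sup>2"
      using par[of c] out[OF pq(1)] out[OF pq(2)] kl by simp
    then have "k \<le> r - \<delta>"
      using kr \<delta>l by (auto intro: power2_le_imp_le)
    then show ?thesis by simp
  qed
  \<comment> \<open>Since \<open>r \<le> \<parallel>y - z\<parallel> \<le> \<delta> + k \<le> r\<close>, equality holds in the triangle inequality, which
    forces \<open>y - m\<close> to be the multiple \<open>r - k\<close> of \<open>e\<close>.\<close>
  have "r\<^sup>2 \<le> (norm (y - z))\<^sup>2"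
    using avoid[OF yA] r by (intro power_mono) auto
  also have "(norm (y - z))\<^sup>2 = \<delta>\<^sup>2 + 2 * k * ((y - m) \<bullet> e) + k\<^sup>2"
  proof -
    have 1: "y - z = (y - m) + k *\<^sub>R e" by (simp add: mz)
    have 2: "\<delta>\<^sup>2 = (y - m) \<bullet> (y - m)" by (simp add: \<delta>_def norm_minus_commute flip: power2_norm_eq_inner)
    have 3: "e \<bullet> e = 1" using e by (simp add: dot_square_norm)
    show ?thesis
      unfolding 1 2 power2_norm_eq_inner
      by (simp add: inner_add_left inner_add_right inner_commute power2_eq_square algebra_simps 3)
  qed
  finally have ineq: "r\<^sup>2 \<le> \<delta>\<^sup>2 + 2 * k * ((y - m) \<bullet> e) + k\<^sup>2" .
  have \<delta>2: "\<delta>\<^sup>2 \<le> (r - k)\<^sup>2" using close by (intro power_mono) (auto simp: \<delta>_def)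
  have "2 * k * (r - k) \<le> 2 * k * ((y - m) \<bullet> e)"
    using ineq \<delta>2 by (simp add: power2_eq_square algebra_simps)
  then have ie: "r - k \<le> (y - m) \<bullet> e" using k by simp
  have "(norm ((y - m) - (r - k) *\<^sub>R e))\<^sup>2 = \<delta>\<^sup>2 - 2 * (r - k) * ((y - m) \<bullet> e) + (r - k)\<^sup>2"
  proof -
    have 2: "\<delta>\<^sup>2 = (y - m) \<bullet> (y - m)" by (simp add: \<delta>_def norm_minus_commute flip: power2_norm_eq_inner)
    have 3: "e \<bullet> e = 1" using e by (simp add: dot_square_norm)
    show ?thesis
      unfolding 2 power2_norm_eq_inner
      by (simp add: inner_diff_left inner_diff_right inner_commute power2_eq_square algebra_simps 3)
  qed
  also have "\<dots> \<le> 2 * (r - k)\<^sup>2 - 2 * (r - k) * ((y - m) \<bullet> e)" using \<delta>2 by simp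
  also have "\<dots> \<le> 0"
    using mult_left_mono[OF ie, of "2 * (r - k)"] kr by (simp add: power2_eq_square algebra_simps)
  finally have "y - m = (r - k) *\<^sub>R e" by (simp add: power2_less_0)
  then have "y = z + r *\<^sub>R e" by (simp add: mz algebra_simps)
  then show ?thesis using yA by simp
qed

text \<open>Otherwise the gap of \<open>T\<close> around \<open>t\<close> has end points in \<open>T\<close>, whose midpoint lies in the gap.\<close>

lemma closed_midpoint_imp_interval:
  fixes T :: "real set"
  assumes "closed T" "a \<in> T" "b \<in> T" "t \<in> {a..b}"
    and mid: "\<And>u v. u \<in> T \<Longrightarrow> v \<in> T \<Longrightarrow> a \<le> u \<Longrightarrow> u < v \<Longrightarrow> v \<le> b \<Longrightarrow> (u + v) / 2 \<in> T"
  shows "t \<in> T"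
proof (rule ccontr)
  assume t: "t \<notin> T"
  let ?L = "T \<inter> {a..t}" and ?R = "T \<inter> {t..b}"
  have c: "compact ?L" "compact ?R" using assms(1) by (simp_all add: closed_Int_compact)
  have "?L \<noteq> {}" "?R \<noteq> {}" using assms(2-4) by auto
  then obtain u v where u: "u \<in> ?L" "\<And>x. x \<in> ?L \<Longrightarrow> x \<le> u" and v: "v \<in> ?R" "\<And>x. x \<in> ?R \<Longrightarrow> v \<le> x"
    using compact_attains_sup[OF c(1)] compact_attains_inf[OF c(2)] by metis
  have "u \<noteq> t" "v \<noteq> t" using u v t by auto
  then have uv: "u < t" "t < v" using u(1) v(1) by auto
  have w: "(u + v) / 2 \<in> T" using mid[of u v] u(1) v(1) uv by auto
  show False
  proof (cases "(u + v) / 2 \<le> t")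
    case True
    then show False using u(2)[of "(u+v)/2"] w u(1) uv by auto
  next
    case False
    then show False using v(2)[of "(u+v)/2"] w v(1) uv by auto
  qed
qed

definition circle_arc :: "'a::euclidean_space \<Rightarrow> real \<Rightarrow> 'a \<Rightarrow> 'a \<Rightarrow> real \<Rightarrow> 'a" where
  "circle_arc z r e1 e2 t = z + r *\<^sub>R (cos t *\<^sub>R e1 + sin t *\<^sub>R e2)"

lemma norm_cos_sin_orthonormal:
  assumes "norm e1 = 1" "norm e2 = 1" "e1 \<bullet> e2 = 0"
  shows "norm (cos t *\<^sub>R e1 + sin t *\<^sub>R e2) = 1"
proof -
  have "(norm (cos t *\<^sub>R e1 + sin t *\<^sub>R e2))\<^sup>2 = (cos t)\<^sup>2 * (norm e1)\<^sup>2 + (sin t)\<^sup>2 * (norm e2)\<^sup>2"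
    unfolding power2_norm_eq_inner using assms
    by (simp add: inner_add_left inner_add_right inner_commute power2_eq_square algebra_simps)
  then have "(norm (cos t *\<^sub>R e1 + sin t *\<^sub>R e2))\<^sup>2 = 1" using assms by simp
  then show ?thesis by (simp add: power2_eq_1_iff)
      (smt (verit) norm_ge_zero)
qed

text \<open>Iterating the midpoint construction fills a dense subset of the shorter arc between two points
  of the sphere, and closedness gives the whole arc.\<close>

lemma circle_arc_subset:
  fixes A :: "'a::euclidean_space set"
  assumes A: "compact A" and r: "0 < r" "ereal r \<le> reach A"
    and avoid: "\<And>a. a \<in> A \<Longrightarrow> r \<le> norm (a - z)"
    and on: "norm e1 = 1" "norm e2 = 1" "e1 \<bullet> e2 = 0"
    and \<theta>: "\<theta> < pi" and ends: "circle_arc z r e1 e2 0 \<in> A" "circle_arc z r e1 e2 \<theta> \<in> A"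
    and t: "t \<in> {0..\<theta>}"
  shows "circle_arc z r e1 e2 t \<in> A"
proof -
  let ?c = "circle_arc z r e1 e2"
  have "continuous_on UNIV ?c"
    unfolding circle_arc_def by (intro continuous_intros)
  then have clo: "closed (?c -` A)"
    using A compact_imp_closed closed_vimage by blast
  have "t \<in> ?c -` A"
  proof (rule closed_midpoint_imp_interval[OF clo _ _ t])
    fix u v assume uv: "u \<in> ?c -` A" "v \<in> ?c -` A" "0 \<le> u" "u < v" "v \<le> \<theta>"
    let ?e = "cos ((u + v) / 2) *\<^sub>R e1 + sin ((u + v) / 2) *\<^sub>R e2"
    define k where "k = r * cos ((v - u) / 2)"
    have "0 < cos ((v - u) / 2)" using uv \<theta> by (intro cos_gt_zero_pi) auto
    then have k: "0 < k" using r by (simp add: k_def)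
    have sums: "cos u + cos v = 2 * cos ((v - u) / 2) * cos ((u + v) / 2)"
        "sin u + sin v = 2 * cos ((v - u) / 2) * sin ((u + v) / 2)"
      using cos_plus_cos[of v u] sin_plus_sin[of v u] by (simp_all add: add.commute mult.commute)
    have mid: "midpoint (?c u) (?c v) - z = k *\<^sub>R ?e"
    proof -
      have "midpoint (?c u) (?c v) - z
          = (r / 2) *\<^sub>R ((cos u + cos v) *\<^sub>R e1 + (sin u + sin v) *\<^sub>R e2)"
      proof -
        have "?c u + ?c v = 2 *\<^sub>R z + r *\<^sub>R ((cos u + cos v) *\<^sub>R e1 + (sin u + sin v) *\<^sub>R e2)"
          by (simp add: circle_arc_def algebra_simps scaleR_2)
        then show ?thesis by (simp add: midpoint_def scaleR_add_right)
      qed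
      then show ?thesis unfolding sums k_def by (simp add: algebra_simps)
    qed
    have "z + r *\<^sub>R ?e \<in> A"
      using uv r norm_cos_sin_orthonormal[OF on] avoid k mid
      by (intro arc_midpoint_mem[OF A, where p = "?c u" and q = "?c v" and k = k])
        (auto simp: circle_arc_def)
    then show "(u + v) / 2 \<in> ?c -` A" by (simp add: circle_arc_def)
  qed (use ends in auto)
  then show ?thesis by simp
qed

text \<open>Along a curve in \<open>A\<close> through \<open>p\<close>, the squared distance to \<open>z\<close> is minimal at \<open>p\<close>.\<close>

lemma nearest_point_orthogonal:
  assumes p: "p \<in> nearest_points A z" and v: "v \<in> tangent_space A p"
  shows "(z - p) \<bullet> v = 0"
proof -
  obtain c e where c: "e > 0" "c ` {-e<..<e} \<subseteq> A" "c 0 = p" "(c has_vector_derivative v) (at (0::real))"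
    using v unfolding tangent_space_def by blast
  have "((\<lambda>t. (c t - z) \<bullet> (c t - z)) has_real_derivative 2 * (v \<bullet> (p - z))) (at 0)"
    using c(4) c(3) unfolding has_vector_derivative_def has_field_derivative_def
    by (auto intro!: derivative_eq_intros simp: inner_commute algebra_simps)
  then have "2 * (v \<bullet> (p - z)) = 0"
  proof (rule DERIV_local_min[OF _ c(1)], intro allI impI)
    fix y :: real assume "\<bar>0 - y\<bar> < e"
    then have "c y \<in> A" using c(2) by (auto simp: image_subset_iff abs_less_iff)
    then have "norm (p - z) \<le> norm (c y - z)" using p by (simp add: nearest_points_iff)
    then show "(c 0 - z) \<bullet> (c 0 - z) \<le> (c y - z) \<bullet> (c y - z)"
      using c(3) by (simp add: norm_le)
  qed
  then show ?thesis by (simp add: inner_commute inner_diff_right)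
qed

text \<open>By Pythagoras, \<open>0\<close> is the only point of the tangent space closest to a vector that is orthogonal to all
  of it.\<close>

lemma covariant_acceleration_eq_0:
  assumes "\<gamma> t \<in> M" and orth: "\<And>v. v \<in> tangent_space M (\<gamma> t) \<Longrightarrow> acceleration \<gamma> t \<bullet> v = 0"
  shows "covariant_acceleration M \<gamma> t = 0"
proof -
  let ?T = "tangent_space M (\<gamma> t)" and ?a = "acceleration \<gamma> t"
  have zero: "0 \<in> ?T"
    unfolding tangent_space_def using assms(1)
    by (auto intro!: exI[of _ "\<lambda>_. \<gamma> t"] exI[of _ 1] derivative_eq_intros)
  have pyth: "(dist ?a v)\<^sup>2 = (norm ?a)\<^sup>2 + (norm v)\<^sup>2" if "v \<in> ?T" for v
    using orth[OF that] unfolding dist_norm power2_norm_eq_inner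
    by (simp add: inner_diff_left inner_diff_right inner_commute)
  show ?thesis
    unfolding covariant_acceleration_def closest_point_def
  proof (rule some_equality)
    have "dist ?a 0 \<le> dist ?a y" if "y \<in> ?T" for y
      by (rule power2_le_imp_le) (simp_all add: pyth[OF that])
    then show "0 \<in> ?T \<and> (\<forall>y\<in>?T. dist ?a 0 \<le> dist ?a y)"
      using zero by blast
    fix v assume v: "v \<in> ?T \<and> (\<forall>y\<in>?T. dist ?a v \<le> dist ?a y)"
    then have "(dist ?a v)\<^sup>2 \<le> (dist ?a 0)\<^sup>2"
      using zero by (intro power_mono) auto
    then show "v = 0" using pyth[of v] v by auto
  qed
qed

text \<open>On the arc the acceleration points to the centre, which is normal to \<open>M\<close> because every point of the
  arc is nearest to the centre.\<close>

lemma circle_arc_geodesic: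
  fixes M :: "'a::euclidean_space set"
  assumes r: "0 < r" and avoid: "\<And>a. a \<in> M \<Longrightarrow> r \<le> norm (a - z)"
    and on: "norm e1 = 1" "norm e2 = 1" "e1 \<bullet> e2 = 0"
    and sub: "\<And>t. t \<in> {0..\<theta>} \<Longrightarrow> circle_arc z r e1 e2 t \<in> M" and \<theta>: "0 < \<theta>"
  shows "\<exists>q0\<in>M. \<exists>I \<gamma>. 0 \<in> I \<and> arclength_geodesic M I \<gamma> \<and> \<gamma> 0 = q0 \<and> norm (acceleration \<gamma> 0) = 1 / r"
proof -
  define s where "s = (\<lambda>t::real. \<theta> / 2 + t / r)"
  define \<gamma> where "\<gamma> = (\<lambda>t. circle_arc z r e1 e2 (s t))"
  define I where "I = {- (r * \<theta> / 2) <..< r * \<theta> / 2}"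
  have s: "(s has_vector_derivative 1 / r) (at t)" for t
    unfolding s_def by (auto intro!: derivative_eq_intros)
  have sI: "s t \<in> {0..\<theta>}" if "t \<in> I" for t
    using that r by (auto simp: s_def I_def field_simps)
  have d1: "(\<gamma> has_vector_derivative (cos (s t) *\<^sub>R e2 - sin (s t) *\<^sub>R e1)) (at t)" for t
  proof -
    have "(\<gamma> has_vector_derivative
        r *\<^sub>R ((- sin (s t) * (1 / r)) *\<^sub>R e1 + (cos (s t) * (1 / r)) *\<^sub>R e2)) (at t)"
      unfolding \<gamma>_def circle_arc_def s_def using r
      by (auto intro!: derivative_eq_intros simp: field_simps)
    then show ?thesis using r by (simp add: algebra_simps)
  qed
  have vel: "velocity \<gamma> = (\<lambda>t. cos (s t) *\<^sub>R e2 - sin (s t) *\<^sub>R e1)"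
    using vector_derivative_at[OF d1] by (auto simp: velocity_def)
  have d2: "(velocity \<gamma> has_vector_derivative
      - ((1 / r) *\<^sub>R (cos (s t) *\<^sub>R e1 + sin (s t) *\<^sub>R e2))) (at t)" for t
  proof -
    have "(velocity \<gamma> has_vector_derivative
        ((- sin (s t) * (1 / r)) *\<^sub>R e2 - (cos (s t) * (1 / r)) *\<^sub>R e1)) (at t)"
      unfolding vel s_def using r by (auto intro!: derivative_eq_intros simp: field_simps)
    then show ?thesis
      by (simp add: scaleR_add_right minus_diff_commute[of "(cos (s t) / r) *\<^sub>R e1"])
  qed
  have acc: "acceleration \<gamma> = (\<lambda>t. - ((1 / r) *\<^sub>R (cos (s t) *\<^sub>R e1 + sin (s t) *\<^sub>R e2)))"
    using vector_derivative_at[OF d2] by (auto simp: acceleration_def)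
  have inM: "\<gamma> t \<in> M" if "t \<in> I" for t
    using sub sI[OF that] by (simp add: \<gamma>_def)
  have near: "\<gamma> t \<in> nearest_points M z" if "t \<in> I" for t
    using inM[OF that] avoid norm_cos_sin_orthonormal[OF on] r
    by (auto simp: nearest_points_iff \<gamma>_def circle_arc_def)
  have "arclength_geodesic M I \<gamma>"
    unfolding arclength_geodesic_def
  proof (intro conjI ballI)
    fix t assume t: "t \<in> I"
    show "\<gamma> differentiable at t" "velocity \<gamma> differentiable at t"
      using d1 d2 by (auto intro: differentiableI_vector)
    show "norm (velocity \<gamma> t) = 1"
      using norm_cos_sin_orthonormal[OF on(2) _ , of "- e1" "s t"] on
      by (simp add: vel inner_commute)
    have "z - \<gamma> t = - (r *\<^sub>R (cos (s t) *\<^sub>R e1 + sin (s t) *\<^sub>R e2))"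
      by (simp add: \<gamma>_def circle_arc_def)
    then have "acceleration \<gamma> t = (1 / r\<^sup>2) *\<^sub>R (z - \<gamma> t)"
      using r by (simp add: acc power2_eq_square)
    then show "covariant_acceleration M \<gamma> t = 0"
      using nearest_point_orthogonal[OF near[OF t]] inM[OF t]
      by (intro covariant_acceleration_eq_0) auto
  next
    show "continuous_on I (acceleration \<gamma>)"
      unfolding acc s_def by (intro continuous_intros) (use r in auto)
  qed (use inM in \<open>auto simp: I_def is_interval_oo\<close>)
  moreover have "0 \<in> I" using r \<theta> by (simp add: I_def)
  moreover have "norm (acceleration \<gamma> 0) = 1 / r"
    using norm_cos_sin_orthonormal[OF on] r by (simp add: acc)
  ultimately show ?thesis using inM by blast
qed

text \<open>The angle at \<open>z\<close> lies strictly between \<open>0\<close> and \<open>pi\<close> because the chord is neither zero nor a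
  diameter; Gram-Schmidt then provides the frame.\<close>

lemma exists_circle_arc:
  fixes p q z :: "'a::euclidean_space"
  assumes r: "0 < r" and p: "norm (p - z) = r" and q: "norm (q - z) = r"
    and ne: "p \<noteq> q" "norm (p - q) \<noteq> 2 * r"
  obtains e1 e2 \<theta> where "norm e1 = 1" "norm e2 = 1" "e1 \<bullet> e2 = 0" "0 < \<theta>" "\<theta> < pi"
    "circle_arc z r e1 e2 0 = p" "circle_arc z r e1 e2 \<theta> = q"
proof -
  define e1 where "e1 = (1 / r) *\<^sub>R (p - z)"
  define f where "f = (1 / r) *\<^sub>R (q - z)"
  have e1: "norm e1 = 1" and f: "norm f = 1" using p q r by (auto simp: e1_def f_def)
  have pq: "p = z + r *\<^sub>R e1" "q = z + r *\<^sub>R f" using r by (auto simp: e1_def f_def)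
  define \<kappa> where "\<kappa> = e1 \<bullet> f"
  have sq: "e1 \<bullet> e1 = 1" "f \<bullet> f = 1" using e1 f by (auto simp: dot_square_norm)
  have k: "e1 \<bullet> f = \<kappa>" "f \<bullet> e1 = \<kappa>" by (simp_all add: \<kappa>_def inner_commute)
  have m: "(norm (e1 - f))\<^sup>2 = 2 - 2 * \<kappa>" 
    using sq by (simp add: power2_norm_eq_inner inner_diff_left inner_diff_right inner_commute \<kappa>_def)
  have "p - q = r *\<^sub>R (e1 - f)" by (simp add: pq algebra_simps)
  then have npq: "norm (p - q) = r * norm (e1 - f)" using r by simp
  have "e1 \<noteq> f" using ne pq by auto
  then have k1: "\<kappa> < 1" using m by (smt (verit) norm_eq_zero eq_iff_diff_eq_0 zero_less_power2)
  have "norm (e1 - f) \<noteq> 2" using ne npq by auto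
  then have "(norm (e1 - f))\<^sup>2 \<noteq> 2\<^sup>2" by (subst power2_eq_iff) (use norm_ge_zero in \<open>smt (verit)\<close>)
  then have "\<kappa> \<noteq> -1" using m by auto
  moreover have "\<bar>\<kappa>\<bar> \<le> 1" using Cauchy_Schwarz_ineq2[of e1 f] e1 f by (simp add: \<kappa>_def)
  ultimately have k2: "-1 < \<kappa>" by auto
  define \<theta> where "\<theta> = arccos \<kappa>"
  have \<theta>: "0 < \<theta>" "\<theta> < pi" using arccos_lt_bounded[OF k2 k1] by (auto simp: \<theta>_def)
  have c: "cos \<theta> = \<kappa>" using k1 k2 by (simp add: \<theta>_def)
  have s: "0 < sin \<theta>" using \<theta> by (simp add: sin_gt_zero)
  define e2 where "e2 = (1 / sin \<theta>) *\<^sub>R (f - \<kappa> *\<^sub>R e1)"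
  have "(norm (f - \<kappa> *\<^sub>R e1))\<^sup>2 = 1 - \<kappa>\<^sup>2"
    unfolding power2_norm_eq_inner
    using sq k by (simp add: inner_diff_left inner_diff_right power2_eq_square)
  also have "\<dots> = (sin \<theta>)\<^sup>2" using c by (simp add: sin_squared_eq)
  finally have "norm (f - \<kappa> *\<^sub>R e1) = sin \<theta>" using s by (simp add: power2_eq_iff_nonneg)
  then have e2: "norm e2 = 1" using s by (simp add: e2_def)
  have orth: "e1 \<bullet> e2 = 0" using sq by (simp add: e2_def inner_diff_right flip: \<kappa>_def)
  show thesis
  proof (rule that[OF e1 e2 orth \<theta>])
    show "circle_arc z r e1 e2 0 = p" "circle_arc z r e1 e2 \<theta> = q"
      using s by (simp_all add: circle_arc_def pq e2_def c)
  qed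
qed

section \<open>Peano's existence theorem\<close>

lemma vector_derivative_zero_imp_eq:
  fixes f :: "real \<Rightarrow> 'b::real_normed_vector"
  assumes "\<And>t. t \<in> {-b..b} \<Longrightarrow> (f has_vector_derivative 0) (at t within {-b..b})"
    and "t \<in> {-b..b}"
  shows "f t = f 0"
proof (rule has_derivative_zero_unique[of "{-b..b}"])
  show "\<And>x. x \<in> {-b..b} \<Longrightarrow> (f has_derivative (\<lambda>h. 0)) (at x within {-b..b})"
    using assms(1) by (force simp: has_vector_derivative_def)
qed (use assms(2) in auto)

text \<open>The shift by \<open>\<delta>\<close> is directed towards time \<open>0\<close>, so that a single delay equation treats both time
  directions.\<close>

definition delay :: "real \<Rightarrow> real \<Rightarrow> real" where
  "delay \<delta> t = sgn t * max (\<bar>t\<bar> - \<delta>) 0"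

lemma abs_delay: "0 \<le> \<delta> \<Longrightarrow> \<bar>delay \<delta> t\<bar> = max (\<bar>t\<bar> - \<delta>) 0"
  by (cases "t = 0") (auto simp: delay_def abs_mult)

lemma delay_mem:
  assumes "0 \<le> \<delta>" "t \<in> {-e..e}"
  shows "delay \<delta> t \<in> {-e..e}"
proof -
  have "\<bar>delay \<delta> t\<bar> \<le> \<bar>t\<bar>" using assms(1) by (simp add: abs_delay)
  then show ?thesis using assms(2) by auto
qed

lemma delay_eq: "0 \<le> \<delta> \<Longrightarrow> delay \<delta> t = max (t - \<delta>) 0 + min (t + \<delta>) 0"
  by (cases t "0::real" rule: linorder_cases) (auto simp: delay_def max_def min_def)

lemma continuous_on_delay: "0 \<le> \<delta> \<Longrightarrow> continuous_on S (delay \<delta>)"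
  by (subst continuous_on_cong[OF refl delay_eq]) (auto intro!: continuous_intros)

lemma dist_delay: "0 \<le> \<delta> \<Longrightarrow> \<bar>delay \<delta> t - t\<bar> \<le> \<delta>"
  by (auto simp: delay_eq max_def min_def)

text \<open>The delay equation determines its solution successively on intervals of length \<open>\<delta>\<close>: the
  \<open>k\<close>-th Picard iterate is already correct up to time \<open>k \<delta>\<close>.\<close>

lemma delay_equation_solution:
  fixes F :: "'b::euclidean_space \<Rightarrow> 'b"
  assumes F: "continuous_on UNIV F" and e: "0 < e"
  obtains x where "x 0 = y0"
    "\<And>t. t \<in> {-e..e} \<Longrightarrow> (x has_vector_derivative F (x (delay (e / real (Suc N)) t))) (at t within {-e..e})"
proof -
  define \<delta> where "\<delta> = e / real (Suc N)"
  have \<delta>: "0 < \<delta>" and N\<delta>: "real (Suc N) * \<delta> = e" using e by (auto simp: \<delta>_def)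
  have dI: "delay \<delta> t \<in> {-e..e}" if "t \<in> {-e..e}" for t
    using delay_mem \<delta> that by simp
  have "\<exists>y. continuous_on {-e..e} y \<and> y 0 = y0 \<and>
      (\<forall>t\<in>{-e..e}. (y has_vector_derivative F (x (delay \<delta> t))) (at t within {-e..e}))"
    if "continuous_on {-e..e} x" for x
  proof -
    have "continuous_on {-e..e} (\<lambda>t. x (delay \<delta> t))"
      using \<delta> dI by (intro continuous_on_compose2[OF that] continuous_on_delay) auto
    then have "continuous_on {-e..e} (\<lambda>t. F (x (delay \<delta> t)))"
      by (intro continuous_on_compose2[OF F]) auto
    then obtain g where g: "\<And>t. t \<in> {-e..e} \<Longrightarrow>
        (g has_vector_derivative F (x (delay \<delta> t))) (at t within {-e..e})"
      using antiderivative_continuous by blast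
    then have g': "((\<lambda>t. g t - g 0 + y0) has_vector_derivative F (x (delay \<delta> t))) (at t within {-e..e})"
      if "t \<in> {-e..e}" for t
      using that by (auto intro!: derivative_eq_intros)
    then have "continuous_on {-e..e} (\<lambda>t. g t - g 0 + y0)"
      by (intro continuous_on_vector_derivative)
    with g' show ?thesis by (intro exI[of _ "\<lambda>t. g t - g 0 + y0"]) simp
  qed
  then obtain \<Phi> where \<Phi>: "\<And>x. continuous_on {-e..e} x \<Longrightarrow> continuous_on {-e..e} (\<Phi> x)"
      "\<And>x. continuous_on {-e..e} x \<Longrightarrow> \<Phi> x 0 = y0"
      "\<And>x t. continuous_on {-e..e} x \<Longrightarrow> t \<in> {-e..e} \<Longrightarrow>
        (\<Phi> x has_vector_derivative F (x (delay \<delta> t))) (at t within {-e..e})"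
    by metis
  define X where "X = (\<lambda>k. (\<Phi> ^^ k) (\<lambda>_. y0))"
  have X: "X 0 = (\<lambda>_. y0)" "X (Suc k) = \<Phi> (X k)" for k by (auto simp: X_def)
  have cont: "continuous_on {-e..e} (X k)" for k
    by (induction k) (auto simp: X \<Phi>)
  have X0: "X k 0 = y0" for k
    by (cases k) (auto simp: X \<Phi> cont)
  have agree: "\<bar>t\<bar> \<le> real k * \<delta> \<Longrightarrow> \<bar>t\<bar> \<le> e \<Longrightarrow> X (Suc k) t = X k t" for k t
  proof (induction k arbitrary: t)
    case 0
    then show ?case by (simp add: X0)
  next
    case (Suc k)
    define b where "b = min (real (Suc k) * \<delta>) e"
    have sub: "{-b..b} \<subseteq> {-e..e}" by (auto simp: b_def)
    have "(\<lambda>t. X (Suc (Suc k)) t - X (Suc k) t) t = (\<lambda>t. X (Suc (Suc k)) t - X (Suc k) t) 0"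
    proof (rule vector_derivative_zero_imp_eq)
      fix s assume s: "s \<in> {-b..b}"
      then have "\<bar>s\<bar> \<le> real k * \<delta> + \<delta>" "\<bar>s\<bar> \<le> e"
        by (auto simp: b_def algebra_simps)
      then have "\<bar>delay \<delta> s\<bar> \<le> real k * \<delta>" "\<bar>delay \<delta> s\<bar> \<le> e"
        using \<delta> by (auto simp: abs_delay)
      then have eq: "X (Suc k) (delay \<delta> s) = X k (delay \<delta> s)" by (rule Suc.IH)
      have "(X (Suc j) has_vector_derivative F (X j (delay \<delta> s))) (at s within {-b..b})" for j
        unfolding X(2) using \<Phi>(3)[OF cont] s sub
        by (meson has_vector_derivative_within_subset subsetD)
      from has_vector_derivative_diff[OF this[of "Suc k"] this[of k]]
      show "((\<lambda>t. X (Suc (Suc k)) t - X (Suc k) t) has_vector_derivative 0) (at s within {-b..b})"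
        using eq by simp
    next
      show "t \<in> {-b..b}" using Suc.prems by (auto simp: b_def)
    qed
    then show ?case by (simp add: X0)
  qed
  show thesis
  proof (rule that)
    show "X (Suc (Suc N)) 0 = y0" by (rule X0)
    fix t assume t: "t \<in> {-e..e}"
    have "\<bar>delay \<delta> t\<bar> \<le> e" using dI[OF t] by auto
    then have "X (Suc (Suc N)) (delay \<delta> t) = X (Suc N) (delay \<delta> t)"
      using agree[of "delay \<delta> t" "Suc N"] N\<delta> by simp
    then show "(X (Suc (Suc N)) has_vector_derivative
        F (X (Suc (Suc N)) (delay (e / real (Suc N)) t))) (at t within {-e..e})"
      using \<Phi>(3)[OF cont[of "Suc N"] t] by (simp add: X(2)[of "Suc N"] \<delta>_def)
  qed
qed

text \<open>The solutions of the delay equations are equi-Lipschitz. A uniform limit along a subsequence,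
  given by the Arzela-Ascoli theorem, solves the equation without delay.\<close>

theorem Peano_existence:
  fixes F :: "'b::euclidean_space \<Rightarrow> 'b"
  assumes F: "continuous_on (cball y0 R) F" and R: "0 < R"
  obtains e y where "0 < e" "y 0 = y0"
    "\<And>t. t \<in> {-e<..<e} \<Longrightarrow> y t \<in> cball y0 R"
    "\<And>t. t \<in> {-e<..<e} \<Longrightarrow> (y has_vector_derivative F (y t)) (at t)"
proof -
  \<comment> \<open>A bounded continuous extension of \<open>F\<close> to the whole space; its solutions move with speed at
    most \<open>B\<close> and so stay in the ball, where it agrees with \<open>F\<close>, up to time \<open>R / B\<close>.\<close>
  define H where "H = (\<lambda>y. F (closest_point (cball y0 R) y))"
  have ne: "cball y0 R \<noteq> {}" using R by simp
  have cp: "closest_point (cball y0 R) y \<in> cball y0 R" for y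
    by (rule closest_point_in_set[OF closed_cball ne])
  have H: "continuous_on UNIV H"
    unfolding H_def
    by (rule continuous_on_compose2[OF F continuous_on_closest_point]) (use cp ne in auto)
  have HF: "H y = F y" if "y \<in> cball y0 R" for y
    by (simp add: H_def closest_point_self[OF that])
  have "bounded (F ` cball y0 R)"
    using compact_continuous_image[OF F compact_cball] compact_imp_bounded by blast
  then obtain B where B: "0 < B" "\<And>y. y \<in> cball y0 R \<Longrightarrow> norm (F y) \<le> B"
    by (auto simp: bounded_pos)
  have HB: "norm (H y) \<le> B" for y unfolding H_def by (rule B(2)[OF cp])
  define e where "e = R / B"
  have e: "0 < e" using R B by (simp add: e_def)
  let ?I = "{-e..e}"
  have "\<forall>N. \<exists>x. x 0 = y0 \<and> (\<forall>t\<in>?I. (x has_vector_derivative H (x (delay (e / real (Suc N)) t))) (at t within ?I))"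
    using delay_equation_solution[OF H e] by metis
  then obtain x where x0: "\<And>N. x N 0 = y0"
      and x': "\<And>N t. t \<in> ?I \<Longrightarrow> (x N has_vector_derivative H (x N (delay (e / real (Suc N)) t))) (at t within ?I)"
    by metis
  have lip: "norm (x N s - x N t) \<le> B * norm (s - t)" if "s \<in> ?I" "t \<in> ?I" for N s t
  proof (rule differentiable_bound[OF _ _ _ that])
    fix u assume "u \<in> ?I"
    then show "(x N has_derivative (\<lambda>h. h *\<^sub>R H (x N (delay (e / real (Suc N)) u)))) (at u within ?I)"
      using x' by (simp add: has_vector_derivative_def)
    show "onorm (\<lambda>h. h *\<^sub>R H (x N (delay (e / real (Suc N)) u))) \<le> B"
      by (rule onorm_bound) (use B(1) HB in \<open>auto simp: mult.commute[of B] intro: mult_left_mono\<close>)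
  qed simp
  have ball: "x N t \<in> cball y0 R" if "t \<in> ?I" for N t
  proof -
    have "norm (x N t - x N 0) \<le> B * norm (t - 0)" using that e by (intro lip) auto
    also have "\<dots> \<le> B * e" using that B(1) by (intro mult_left_mono) auto
    also have "\<dots> = R" using B(1) by (simp add: e_def)
    finally show ?thesis by (simp add: x0 dist_norm norm_minus_commute)
  qed
  have "\<exists>y k. continuous_on ?I y \<and> strict_mono (k :: nat \<Rightarrow> nat) \<and>
      (\<forall>\<epsilon>>0. \<exists>N. \<forall>n t. n \<ge> N \<and> t \<in> ?I \<longrightarrow> norm (x (k n) t - y t) < \<epsilon>)"
  proof (rule Arzela_Ascoli[of ?I x "norm y0 + R"])
    show "norm (x n t) \<le> norm y0 + R" if "t \<in> ?I" for n t
      using ball[OF that, of n] norm_triangle_sub[of "x n t" y0]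
      by (simp add: dist_norm norm_minus_commute)
    show "\<exists>d. 0 < d \<and> (\<forall>n s. s \<in> ?I \<and> norm (t - s) < d \<longrightarrow> norm (x n t - x n s) < \<epsilon>)"
      if t: "t \<in> ?I" and "0 < \<epsilon>" for t \<epsilon>
    proof (intro exI[of _ "\<epsilon> / B"] conjI allI impI)
      show "0 < \<epsilon> / B" using that B by simp
      fix n s assume s: "s \<in> ?I \<and> norm (t - s) < \<epsilon> / B"
      have "norm (x n t - x n s) \<le> B * norm (t - s)" using lip t s by blast
      also have "\<dots> < \<epsilon>" using s B(1) by (simp add: field_simps)
      finally show "norm (x n t - x n s) < \<epsilon>" .
    qed
  next
    fix g k
    assume "continuous_on ?I g" "strict_mono (k :: nat \<Rightarrow> nat)"
      "\<And>\<epsilon>. 0 < \<epsilon> \<Longrightarrow> \<exists>N. \<forall>n t. N \<le> n \<and> t \<in> ?I \<longrightarrow> norm (x (k n) t - g t) < \<epsilon>"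
    then show ?thesis by (intro exI[of _ g] exI[of _ k]) blast
  qed simp
  then obtain y k where y: "continuous_on ?I y" and k: "strict_mono (k :: nat \<Rightarrow> nat)"
    and unif: "\<And>\<epsilon>. 0 < \<epsilon> \<Longrightarrow> \<exists>N. \<forall>n t. n \<ge> N \<and> t \<in> ?I \<longrightarrow> norm (x (k n) t - y t) < \<epsilon>"
    by blast
  have lim: "(\<lambda>n. x (k n) t) \<longlonglongrightarrow> y t" if t: "t \<in> ?I" for t
    unfolding LIMSEQ_iff using unif t by blast
  have yball: "y t \<in> cball y0 R" if "t \<in> ?I" for t
    by (rule closed_sequentially[OF closed_cball _ lim[OF that]]) (rule ball[OF that])
  have y0: "y 0 = y0"
    using lim[of 0] e by (simp add: x0 LIMSEQ_const_iff)
  have unif': "\<forall>\<^sub>F n in sequentially. \<forall>t\<in>?I. \<forall>h. 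
      norm (h *\<^sub>R H (x (k n) (delay (e / real (Suc (k n))) t)) - h *\<^sub>R H (y t)) \<le> \<epsilon> * norm h"
    if \<epsilon>: "0 < \<epsilon>" for \<epsilon>
  proof -
    have "uniformly_continuous_on (cball y0 R) H"
      using H by (intro compact_uniformly_continuous) (auto intro: continuous_on_subset)
    then obtain d where d: "d > 0"
      "\<And>u v. u \<in> cball y0 R \<Longrightarrow> v \<in> cball y0 R \<Longrightarrow> dist v u < d \<Longrightarrow> dist (H v) (H u) < \<epsilon>"
      unfolding uniformly_continuous_on_def using \<epsilon> by blast
    obtain N1 where N1: "\<And>n t. n \<ge> N1 \<Longrightarrow> t \<in> ?I \<Longrightarrow> norm (x (k n) t - y t) < d / 2"
      using unif[OF half_gt_zero[OF d(1)]] by blast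
    obtain N2 where N2: "2 * R / d < real N2" using reals_Archimedean2 by blast
    show ?thesis
      unfolding eventually_sequentially
    proof (intro exI[of _ "max N1 N2"] allI impI ballI)
      fix n t h assume n: "max N1 N2 \<le> n" and t: "t \<in> ?I"
      let ?\<delta> = "e / real (Suc (k n))"
      have \<delta>: "0 \<le> ?\<delta>" using e by simp
      have tI: "delay ?\<delta> t \<in> ?I"
        by (rule delay_mem[OF \<delta> t])
      have "norm (x (k n) (delay ?\<delta> t) - x (k n) t) \<le> B * norm (delay ?\<delta> t - t)"
        by (rule lip[OF tI t])
      also have "\<dots> \<le> B * ?\<delta>" using dist_delay[OF \<delta>, of t] B(1) by (intro mult_left_mono) auto
      also have "\<dots> = R / real (Suc (k n))" using B(1) by (simp add: e_def)
      also have "\<dots> < d / 2"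
      proof -
        have "real N2 \<le> real (k n)" using seq_suble[OF k, of n] n by simp
        then have "2 * R / d < real (Suc (k n))" using N2 by simp
        then show ?thesis using d(1) by (simp add: field_simps)
      qed
      finally have "dist (x (k n) (delay ?\<delta> t)) (y t) < d"
        using N1[of n t] n t norm_triangle_ineq[of "x (k n) (delay ?\<delta> t) - x (k n) t" "x (k n) t - y t"]
        by (simp add: dist_norm)
      then have "dist (H (x (k n) (delay ?\<delta> t))) (H (y t)) < \<epsilon>"
        using d(2) ball[OF tI] yball[OF t] by blast
      then have "norm (H (x (k n) (delay ?\<delta> t)) - H (y t)) \<le> \<epsilon>" by (simp add: dist_norm)
      then have "\<bar>h\<bar> * norm (H (x (k n) (delay ?\<delta> t)) - H (y t)) \<le> \<bar>h\<bar> * \<epsilon>"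
        by (intro mult_left_mono) auto
      then show "norm (h *\<^sub>R H (x (k n) (delay ?\<delta> t)) - h *\<^sub>R H (y t)) \<le> \<epsilon> * norm h"
        by (simp add: mult.commute flip: scaleR_diff_right)
    qed
  qed
  have "\<exists>g. \<forall>t\<in>?I. (\<lambda>n. x (k n) t) \<longlonglongrightarrow> g t \<and>
      (g has_derivative (\<lambda>h. h *\<^sub>R H (y t))) (at t within ?I)"
  proof (rule has_derivative_sequence[OF _ _ unif'])
    show "0 \<in> ?I" using e by simp
    show "(\<lambda>n. x (k n) 0) \<longlonglongrightarrow> y0" by (simp add: x0)
  qed (use x' in \<open>auto simp: has_vector_derivative_def\<close>)
  then obtain g where g: "\<And>t. t \<in> ?I \<Longrightarrow> (\<lambda>n. x (k n) t) \<longlonglongrightarrow> g t"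
      "\<And>t. t \<in> ?I \<Longrightarrow> (g has_derivative (\<lambda>h. h *\<^sub>R H (y t))) (at t within ?I)"
    by blast
  have gy: "g t = y t" if "t \<in> ?I" for t
    using g(1)[OF that] lim[OF that] LIMSEQ_unique by blast
  show thesis
  proof (rule that[of e y, OF e y0])
    fix t assume t: "t \<in> {-e<..<e}"
    then have tI: "t \<in> ?I" by auto
    show "y t \<in> cball y0 R" by (rule yball[OF tI])
    have "(y has_derivative (\<lambda>h. h *\<^sub>R H (y t))) (at t within ?I)"
      by (rule has_derivative_transform[OF tI _ g(2)[OF tI]]) (simp add: gy)
    moreover have "at t within ?I = at t"
      by (rule at_within_interior) (use t in \<open>simp add: interior_atLeastAtMost_real\<close>)
    ultimately show "(y has_vector_derivative F (y t)) (at t)"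
      using HF[OF yball[OF tI]] by (simp add: has_vector_derivative_def)
  qed
qed

section \<open>Charts of a submanifold\<close>

text \<open>A subspace is its own double orthogonal complement. This reduces the next two statements about vector
  valued curves to scalar functions that vanish identically or have zero derivative.\<close>

lemma subspace_memI:
  fixes S :: "'a::euclidean_space set"
  assumes "subspace S" and orth: "\<And>n. (\<And>s. s \<in> S \<Longrightarrow> s \<bullet> n = 0) \<Longrightarrow> x \<bullet> n = 0"
  shows "x \<in> S"
proof -
  obtain y z where y: "y \<in> span S" and z: "\<And>w. w \<in> span S \<Longrightarrow> orthogonal z w" and x: "x = y + z"
    using orthogonal_subspace_decomp_exists by blast
  have span: "span S = S" using assms(1) by (simp add: span_eq_iff)
  have "x \<bullet> z = 0"
    using z span by (intro orth) (auto simp: orthogonal_def inner_commute)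
  moreover have "y \<bullet> z = 0"
    using z[OF y] by (simp add: orthogonal_def inner_commute)
  ultimately have "z = 0" by (simp add: x inner_add_left)
  then show ?thesis using x y span by simp
qed

lemma vector_derivative_in_subspace:
  fixes f :: "real \<Rightarrow> 'a::euclidean_space"
  assumes S: "subspace S" and e: "0 < e" and f: "\<And>t. \<bar>t\<bar> < e \<Longrightarrow> f t \<in> S"
    and D: "(f has_vector_derivative D) (at 0)"
  shows "D \<in> S"
proof (rule subspace_memI[OF S])
  fix n assume n: "\<And>s. s \<in> S \<Longrightarrow> s \<bullet> n = 0"
  have "((\<lambda>t. f t \<bullet> n) has_vector_derivative D \<bullet> n) (at 0)"
    by (rule bounded_linear.has_vector_derivative[OF bounded_linear_inner_left D])
  moreover have "((\<lambda>t. f t \<bullet> n) has_vector_derivative 0) (at 0)"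
    by (rule has_vector_derivative_transform_within_open[of "\<lambda>_. 0" _ _ "ball 0 e"])
      (use e f n in auto)
  ultimately show "D \<bullet> n = 0" by (rule vector_derivative_unique_at)
qed

lemma curve_in_subspace:
  fixes f :: "real \<Rightarrow> 'a::euclidean_space"
  assumes S: "subspace S" and e: "0 < e" and f0: "f 0 \<in> S"
    and f: "\<And>t. t \<in> {-e<..<e} \<Longrightarrow> (f has_vector_derivative g t) (at t)"
    and g: "\<And>t. t \<in> {-e<..<e} \<Longrightarrow> g t \<in> S" and t: "t \<in> {-e<..<e}"
  shows "f t \<in> S"
proof (rule subspace_memI[OF S])
  fix n assume n: "\<And>s. s \<in> S \<Longrightarrow> s \<bullet> n = 0"
  have "((\<lambda>t. f t \<bullet> n) has_derivative (\<lambda>h. 0)) (at s within {-e<..<e})" if s: "s \<in> {-e<..<e}" for s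
  proof -
    have "((\<lambda>t. f t \<bullet> n) has_vector_derivative g s \<bullet> n) (at s)"
      by (rule bounded_linear.has_vector_derivative[OF bounded_linear_inner_left f[OF s]])
    then show ?thesis
      using n[OF g[OF s]] by (auto simp: has_vector_derivative_def intro: has_derivative_at_withinI)
  qed
  then have "f t \<bullet> n = f 0 \<bullet> n"
    using has_derivative_zero_unique[of "{-e<..<e}" "\<lambda>t. f t \<bullet> n" t 0] t e by auto
  then show "f t \<bullet> n = 0" using n[OF f0] by simp
qed

text \<open>A chart together with the derivatives that its class provides: \<open>\<psi>\<close> parametrizes an open piece of
  \<open>M\<close> by an open piece of the linear subspace \<open>S\<close>.\<close>

locale C2_chart =
  fixes M U V S :: "'a::euclidean_space set" and \<phi> \<psi> :: "'a \<Rightarrow> 'a"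
    and \<phi>' \<psi>' :: "'a \<Rightarrow> 'a \<Rightarrow>\<^sub>L 'a" and \<psi>'' :: "'a \<Rightarrow> 'a \<Rightarrow>\<^sub>L 'a \<Rightarrow>\<^sub>L 'a"
  assumes open_U: "open U" and open_V: "open V" and homeo: "homeomorphism U V \<phi> \<psi>"
    and \<phi>_deriv: "\<And>x. x \<in> U \<Longrightarrow> (\<phi> has_derivative blinfun_apply (\<phi>' x)) (at x)"
    and \<phi>'_cont: "continuous_on U \<phi>'"
    and \<psi>_deriv: "\<And>u. u \<in> V \<Longrightarrow> (\<psi> has_derivative blinfun_apply (\<psi>' u)) (at u)"
    and \<psi>'_deriv: "\<And>u. u \<in> V \<Longrightarrow> (\<psi>' has_derivative blinfun_apply (\<psi>'' u)) (at u)"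
    and \<psi>''_cont: "continuous_on V \<psi>''"
    and subspace_S: "subspace S"
    and image_M: "\<phi> ` (U \<inter> M) = V \<inter> S"

lemma C2_submanifold_chart:
  assumes "C2_submanifold d M" "p \<in> M"
  obtains U V S \<phi> \<psi> \<phi>' \<psi>' \<psi>'' where "C2_chart M U V S \<phi> \<psi> \<phi>' \<psi>' \<psi>''" "p \<in> U" "dim S = d"
proof -
  have "\<exists>U (V :: 'a set) \<phi> \<psi> S. open U \<and> p \<in> U \<and> open V \<and> homeomorphism U V \<phi> \<psi> \<and>
      C2_on \<phi> U \<and> C2_on \<psi> V \<and> subspace S \<and> dim S = d \<and> \<phi> ` (U \<inter> M) = V \<inter> S"
    using assms unfolding C2_submanifold_def by blast
  then obtain U and V :: "'a set" and \<phi> \<psi> S where *: "open U" "p \<in> U" "open V"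
    "homeomorphism U V \<phi> \<psi>" "C2_on \<phi> U" "C2_on \<psi> V" "subspace S" "dim S = d"
    "\<phi> ` (U \<inter> M) = V \<inter> S"
    by blast
  from *(5) obtain \<phi>' \<phi>'' where \<phi>: "\<forall>x\<in>U. (\<phi> has_derivative blinfun_apply (\<phi>' x)) (at x)"
    "\<forall>x\<in>U. (\<phi>' has_derivative blinfun_apply (\<phi>'' x)) (at x)"
    unfolding C2_on_def by metis
  from *(6) obtain \<psi>' \<psi>'' where \<psi>: "\<forall>x\<in>V. (\<psi> has_derivative blinfun_apply (\<psi>' x)) (at x)"
    "\<forall>x\<in>V. (\<psi>' has_derivative blinfun_apply (\<psi>'' x)) (at x)" "continuous_on V \<psi>''"
    unfolding C2_on_def by metis
  have "continuous_on U \<phi>'"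
    using \<phi>(2) by (meson continuous_at_imp_continuous_on has_derivative_continuous)
  with * \<phi> \<psi> have "C2_chart M U V S \<phi> \<psi> \<phi>' \<psi>' \<psi>''"
    unfolding C2_chart_def by blast
  then show thesis using that *(2,8) by blast
qed

context C2_chart
begin

lemma \<phi>_mem: "x \<in> U \<Longrightarrow> \<phi> x \<in> V"
  and \<psi>_mem: "u \<in> V \<Longrightarrow> \<psi> u \<in> U"
  and \<psi>_\<phi>: "x \<in> U \<Longrightarrow> \<psi> (\<phi> x) = x"
  and \<phi>_\<psi>: "u \<in> V \<Longrightarrow> \<phi> (\<psi> u) = u"
  and \<phi>_cont: "continuous_on U \<phi>"
  and \<psi>_cont: "continuous_on V \<psi>"
  using homeo by (auto simp: homeomorphism_def)

lemma \<phi>_mem_S: "x \<in> U \<Longrightarrow> x \<in> M \<Longrightarrow> \<phi> x \<in> S"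
  using image_M by blast

lemma \<psi>_mem_M: "u \<in> V \<Longrightarrow> u \<in> S \<Longrightarrow> \<psi> u \<in> M"
  using image_M \<psi>_\<phi> by (metis IntE IntI imageE)

lemma \<psi>'_cont: "continuous_on V \<psi>'"
  using \<psi>'_deriv by (meson continuous_at_imp_continuous_on has_derivative_continuous)

lemma \<phi>'_\<psi>': assumes u: "u \<in> V" shows "\<phi>' (\<psi> u) (\<psi>' u w) = w"
proof -
  have "(\<phi> \<circ> \<psi> has_derivative blinfun_apply (\<phi>' (\<psi> u)) \<circ> blinfun_apply (\<psi>' u)) (at u)"
    by (intro diff_chain_at \<psi>_deriv u \<phi>_deriv \<psi>_mem)
  then have "(id has_derivative blinfun_apply (\<phi>' (\<psi> u)) \<circ> blinfun_apply (\<psi>' u)) (at u)"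
    by (rule has_derivative_transform_within_open[OF _ open_V u]) (simp add: \<phi>_\<psi>)
  from has_derivative_unique[OF this has_derivative_id] show ?thesis
    by (simp add: fun_eq_iff)
qed

lemma \<psi>'_\<phi>': assumes x: "x \<in> U" shows "\<psi>' (\<phi> x) (\<phi>' x w) = w"
proof -
  have "(\<psi> \<circ> \<phi> has_derivative blinfun_apply (\<psi>' (\<phi> x)) \<circ> blinfun_apply (\<phi>' x)) (at x)"
    by (intro diff_chain_at \<phi>_deriv x \<psi>_deriv \<phi>_mem)
  then have "(id has_derivative blinfun_apply (\<psi>' (\<phi> x)) \<circ> blinfun_apply (\<phi>' x)) (at x)"
    by (rule has_derivative_transform_within_open[OF _ open_U x]) (simp add: \<psi>_\<phi>)
  from has_derivative_unique[OF this has_derivative_id] show ?thesis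
    by (simp add: fun_eq_iff)
qed

lemma tangent_space_eq:
  assumes u: "u \<in> V" "u \<in> S"
  shows "tangent_space M (\<psi> u) = blinfun_apply (\<psi>' u) ` S"
proof (intro equalityI subsetI)
  fix v assume "v \<in> tangent_space M (\<psi> u)"
  then obtain c e where c: "e > 0" "c ` {-e<..<e} \<subseteq> M" "c 0 = \<psi> u"
      "(c has_vector_derivative v) (at (0::real))"
    unfolding tangent_space_def by blast
  have "isCont c 0"
    using c(4) by (simp add: has_vector_derivative_continuous)
  then have "\<forall>\<^sub>F t in at 0. c t \<in> U"
    using c(3) open_U \<psi>_mem[OF u(1)] by (intro topological_tendstoD) (auto simp: isCont_def)
  then obtain d where d: "d > 0" "\<And>t. t \<noteq> 0 \<Longrightarrow> \<bar>t\<bar> < d \<Longrightarrow> c t \<in> U"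
    unfolding eventually_at by (auto simp: dist_real_def)
  have cU: "c t \<in> U" if "\<bar>t\<bar> < d" for t
    using that d \<psi>_mem[OF u(1)] c(3) by (cases "t = 0") auto
  have "((\<lambda>t. \<phi> (c t)) has_derivative (\<lambda>h. \<phi>' (\<psi> u) (h *\<^sub>R v))) (at 0)"
    using c(3,4) \<phi>_deriv[OF \<psi>_mem[OF u(1)]] unfolding has_vector_derivative_def
    by (intro has_derivative_compose[of c _ 0 UNIV \<phi>]) simp_all
  then have "((\<lambda>t. \<phi> (c t)) has_vector_derivative \<phi>' (\<psi> u) v) (at 0)"
    by (simp add: has_vector_derivative_def blinfun.scaleR_right)
  then have "\<phi>' (\<psi> u) v \<in> S"
  proof (rule vector_derivative_in_subspace[OF subspace_S, rotated 2])
    show "0 < min d e" using d c by simp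
    fix t :: real assume "\<bar>t\<bar> < min d e"
    then show "\<phi> (c t) \<in> S"
      using c(2) by (intro \<phi>_mem_S cU) (auto simp: image_subset_iff abs_less_iff)
  qed
  moreover have "\<psi>' u (\<phi>' (\<psi> u) v) = v"
    using \<psi>'_\<phi>'[OF \<psi>_mem[OF u(1)]] \<phi>_\<psi>[OF u(1)] by simp
  ultimately show "v \<in> blinfun_apply (\<psi>' u) ` S" by force
next
  fix v assume "v \<in> blinfun_apply (\<psi>' u) ` S"
  then obtain s where s: "s \<in> S" "v = \<psi>' u s" by blast
  obtain d where d: "d > 0" "ball u d \<subseteq> V" using open_V u(1) open_contains_ball by blast
  define e where "e = d / (norm s + 1)"
  have e: "e > 0" using d by (simp add: e_def add_nonneg_pos)
  have V: "u + t *\<^sub>R s \<in> V" if "t \<in> {-e<..<e}" for t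
  proof -
    have "\<bar>t\<bar> * norm s \<le> e * norm s" using that by (intro mult_right_mono) auto
    also have "\<dots> < d" using d(1) by (simp add: e_def divide_less_eq add_nonneg_pos)
    finally show ?thesis using d(2) by (auto simp: dist_norm)
  qed
  have "((\<lambda>t. \<psi> (u + t *\<^sub>R s)) has_derivative (\<lambda>h. \<psi>' u (h *\<^sub>R s))) (at 0)"
    by (rule has_derivative_compose[of "\<lambda>t. u + t *\<^sub>R s" "\<lambda>h. h *\<^sub>R s"])
      (auto intro!: derivative_eq_intros \<psi>_deriv u)
  then have "((\<lambda>t. \<psi> (u + t *\<^sub>R s)) has_vector_derivative v) (at 0)"
    by (simp add: has_vector_derivative_def blinfun.scaleR_right s(2))
  moreover have "\<psi> (u + t *\<^sub>R s) \<in> M" if "t \<in> {-e<..<e}" for t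
    using V[OF that] u s subspace_S by (intro \<psi>_mem_M) (auto simp: subspace_add subspace_scale)
  ultimately show "v \<in> tangent_space M (\<psi> u)"
    unfolding tangent_space_def using e
    by (auto intro!: exI[of _ "\<lambda>t. \<psi> (u + t *\<^sub>R s)"] exI[of _ e])
qed

lemma Taylor_inner:
  assumes seg: "closed_segment u (u + h) \<subseteq> V"
  obtains \<xi> where "\<xi> \<in> closed_segment u (u + h)"
    "(\<psi> (u + h) - \<psi> u) \<bullet> m = \<psi>' u h \<bullet> m + (\<psi>'' \<xi> h h \<bullet> m) / 2"
proof -
  define diff where "diff = (\<lambda>(k::nat) t. if k = 0 then \<psi> (u + t *\<^sub>R h) \<bullet> m
     else if k = 1 then \<psi>' (u + t *\<^sub>R h) h \<bullet> m else \<psi>'' (u + t *\<^sub>R h) h h \<bullet> m)"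
  have V: "u + t *\<^sub>R h \<in> V" if "0 \<le> t" "t \<le> 1" for t
    using that seg by (auto simp: closed_segment_def algebra_simps subset_iff)
  have line: "((\<lambda>t. u + t *\<^sub>R h) has_derivative (\<lambda>s. s *\<^sub>R h)) (at t)" for t
    by (auto intro!: derivative_eq_intros)
  have d0: "(diff 0 has_real_derivative diff 1 t) (at t)" if t: "0 \<le> t" "t \<le> 1" for t
  proof -
    have "((\<lambda>t. \<psi> (u + t *\<^sub>R h)) has_derivative (\<lambda>s. \<psi>' (u + t *\<^sub>R h) (s *\<^sub>R h))) (at t)"
      by (rule has_derivative_compose[OF line \<psi>_deriv[OF V[OF t]]])
    from has_derivative_inner_left[OF this, of m] show ?thesis
      by (simp add: diff_def has_field_derivative_def blinfun.scaleR_right mult.commute[of _ "_ \<bullet> _"])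
  qed
  have d1: "(diff 1 has_real_derivative diff 2 t) (at t)" if t: "0 \<le> t" "t \<le> 1" for t
  proof -
    have "((\<lambda>t. \<psi>' (u + t *\<^sub>R h)) has_derivative (\<lambda>s. \<psi>'' (u + t *\<^sub>R h) (s *\<^sub>R h))) (at t)"
      by (rule has_derivative_compose[OF line \<psi>'_deriv[OF V[OF t]]])
    from bounded_linear.has_derivative[OF blinfun.bounded_linear_left[of h] this]
    have "((\<lambda>t. \<psi>' (u + t *\<^sub>R h) h) has_derivative (\<lambda>s. \<psi>'' (u + t *\<^sub>R h) (s *\<^sub>R h) h)) (at t)" .
    from has_derivative_inner_left[OF this, of m] show ?thesis
      by (simp add: diff_def has_field_derivative_def blinfun.scaleR_right blinfun.scaleR_left
          mult.commute[of _ "_ \<bullet> _"])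
  qed
  have "\<exists>t>0. t < 1 \<and> diff 0 1 = (\<Sum>k<2. diff k 0 / fact k * 1 ^ k) + diff 2 t / fact 2 * 1 ^ 2"
  proof (rule Maclaurin)
    show "\<forall>k t. k < 2 \<and> 0 \<le> t \<and> t \<le> 1 \<longrightarrow> (diff k has_real_derivative diff (Suc k) t) (at t)"
    proof (intro allI impI)
      fix k :: nat and t :: real assume kt: "k < 2 \<and> 0 \<le> t \<and> t \<le> 1"
      then consider "k = 0" | "k = 1" by linarith
      then show "(diff k has_real_derivative diff (Suc k) t) (at t)"
        by cases (use kt d0[of t] d1[of t] in \<open>simp_all add: numeral_2_eq_2\<close>)
    qed
  qed auto
  then obtain t where t: "0 < t" "t < 1" "diff 0 1 = diff 0 0 + diff 1 0 + diff 2 t / 2"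
    by (auto simp: numeral_2_eq_2 lessThan_Suc)
  show thesis
  proof (rule that[of "u + t *\<^sub>R h"])
    show "u + t *\<^sub>R h \<in> closed_segment u (u + h)"
      using t by (auto simp: closed_segment_def algebra_simps intro!: exI[of _ t])
    show "(\<psi> (u + h) - \<psi> u) \<bullet> m = \<psi>' u h \<bullet> m + (\<psi>'' (u + t *\<^sub>R h) h h \<bullet> m) / 2"
      using t(3) by (simp add: diff_def inner_diff_left)
  qed
qed

lemma norm_\<psi>''_le: "norm (\<psi>'' \<xi> h h) \<le> norm (\<psi>'' \<xi>) * (norm h)\<^sup>2"
proof -
  have "norm (\<psi>'' \<xi> h h) \<le> norm (\<psi>'' \<xi> h) * norm h" by (rule norm_blinfun)
  also have "\<dots> \<le> (norm (\<psi>'' \<xi>) * norm h) * norm h"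
    by (intro mult_right_mono norm_blinfun) auto
  finally show ?thesis by (simp add: power2_eq_square mult.assoc)
qed

text \<open>Testing the Taylor formula against the remainder itself bounds its norm.\<close>

lemma Taylor_norm:
  assumes seg: "closed_segment u (u + h) \<subseteq> V"
    and C: "\<And>\<xi>. \<xi> \<in> closed_segment u (u + h) \<Longrightarrow> norm (\<psi>'' \<xi>) \<le> C"
  shows "norm (\<psi> (u + h) - \<psi> u - \<psi>' u h) \<le> C * (norm h)\<^sup>2"
proof -
  define E where "E = \<psi> (u + h) - \<psi> u - \<psi>' u h"
  obtain \<xi> where \<xi>: "\<xi> \<in> closed_segment u (u + h)"
    "(\<psi> (u + h) - \<psi> u) \<bullet> E = \<psi>' u h \<bullet> E + (\<psi>'' \<xi> h h \<bullet> E) / 2"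
    using Taylor_inner[OF seg] by blast
  have C0: "0 \<le> C" using C[OF \<xi>(1)] norm_ge_zero order_trans by blast
  have "norm E * norm E = E \<bullet> E" by (simp add: power2_norm_eq_inner flip: power2_eq_square)
  also have "\<dots> = (\<psi>'' \<xi> h h \<bullet> E) / 2" using \<xi>(2) by (simp add: E_def inner_diff_left)
  also have "\<dots> \<le> norm (\<psi>'' \<xi> h h) * norm E"
    using norm_cauchy_schwarz[of "\<psi>'' \<xi> h h" E] mult_nonneg_nonneg[OF norm_ge_zero[of "\<psi>'' \<xi> h h"] norm_ge_zero[of E]]
    by linarith
  also have "\<dots> \<le> (C * (norm h)\<^sup>2) * norm E"
    by (intro mult_right_mono order_trans[OF norm_\<psi>''_le mult_right_mono[OF C[OF \<xi>(1)]]]) auto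
  finally have "norm E * norm E \<le> (C * (norm h)\<^sup>2) * norm E" .
  then have "norm E \<le> C * (norm h)\<^sup>2"
    using C0 by (cases "norm E = 0") (auto simp: mult_le_cancel_right)
  then show ?thesis by (simp add: E_def)
qed

text \<open>Near the base point the submanifold leaves its tangent space at most quadratically, and the remaining
  points are too far away to meet a small tangent ball.\<close>

lemma normal_nearest_point:
  assumes u0: "u0 \<in> V" "u0 \<in> S" and n: "norm n = 1" "\<And>s. s \<in> S \<Longrightarrow> \<psi>' u0 s \<bullet> n = 0"
  shows "\<exists>s>0. \<psi> u0 \<in> nearest_points M (\<psi> u0 + s *\<^sub>R n)"
proof -
  let ?p = "\<psi> u0"
  have pU: "?p \<in> U" by (rule \<psi>_mem[OF u0(1)])
  \<comment> \<open>\<open>C\<close> bounds the second derivative of \<open>\<psi>\<close> near \<open>u0\<close> and \<open>L\<close> is a Lipschitz constant of \<open>\<phi>\<close> at the base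
    point, so a nearby \<open>q\<close> has height at most \<open>C L\<^sup>2 / 2\<close> times its squared distance over the tangent space.\<close>
  define C where "C = norm (\<psi>'' u0) + 1"
  define L where "L = norm (\<phi>' ?p) + 1"
  have C: "1 \<le> C" and L: "1 \<le> L" by (auto simp: C_def L_def)
  obtain \<rho> where \<rho>: "\<rho> > 0" "ball u0 \<rho> \<subseteq> V" "\<And>\<xi>. \<xi> \<in> ball u0 \<rho> \<Longrightarrow> norm (\<psi>'' \<xi>) \<le> C"
  proof -
    obtain d1 where d1: "d1 > 0" "ball u0 d1 \<subseteq> V" using open_V u0(1) open_contains_ball by blast
    have "isCont \<psi>'' u0" using \<psi>''_cont open_V u0(1) continuous_on_eq_continuous_at by blast
    then obtain d2 where d2: "d2 > 0" "\<And>\<xi>. dist \<xi> u0 < d2 \<Longrightarrow> dist (\<psi>'' \<xi>) (\<psi>'' u0) < 1"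
      unfolding continuous_at_eps_delta by (metis zero_less_one)
    show thesis
    proof (rule that[of "min d1 d2"])
      fix \<xi> assume "\<xi> \<in> ball u0 (min d1 d2)"
      then have "norm (\<psi>'' \<xi> - \<psi>'' u0) < 1" using d2(2)[of \<xi>] by (simp add: dist_norm norm_minus_commute)
      then show "norm (\<psi>'' \<xi>) \<le> C"
        using norm_triangle_sub[of "\<psi>'' \<xi>" "\<psi>'' u0"] by (simp add: C_def)
    qed (use d1 d2 in auto)
  qed
  obtain d3 where d3: "d3 > 0" "ball ?p d3 \<subseteq> U" using open_U pU open_contains_ball by blast
  obtain d4 where d4: "d4 > 0"
    "\<And>y. norm (y - ?p) < d4 \<Longrightarrow> norm (\<phi> y - \<phi> ?p - \<phi>' ?p (y - ?p)) \<le> 1 * norm (y - ?p)"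
    using \<phi>_deriv[OF pU] unfolding has_derivative_at_alt by (metis zero_less_one)
  define \<delta> where "\<delta> = min (min d3 d4) (\<rho> / L)"
  have \<delta>: "\<delta> > 0" using d3 d4 \<rho> L by (simp add: \<delta>_def)
  define s where "s = min (\<delta> / 2) (1 / (C * L\<^sup>2))"
  have CL: "0 < C * L\<^sup>2" using C L by (simp add: zero_less_mult_iff)
  have s: "s > 0" using \<delta> CL by (simp add: s_def)
  have key: "2 * s * ((q - ?p) \<bullet> n) \<le> (norm (q - ?p))\<^sup>2" if q: "q \<in> M" for q
  proof (cases "norm (q - ?p) < \<delta>")
    case False
    have "2 * s * ((q - ?p) \<bullet> n) \<le> 2 * s * norm (q - ?p)"
      using s norm_cauchy_schwarz[of "q - ?p" n] n by (intro mult_left_mono) auto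
    also have "\<dots> \<le> \<delta> * norm (q - ?p)" by (intro mult_right_mono) (auto simp: s_def)
    also have "\<dots> \<le> norm (q - ?p) * norm (q - ?p)" using False by (intro mult_right_mono) auto
    finally show ?thesis by (simp add: power2_eq_square)
  next
    case True
    then have qU: "q \<in> U" using d3(2) by (auto simp: \<delta>_def dist_norm norm_minus_commute)
    define h where "h = \<phi> q - u0"
    have "norm h \<le> norm (h - \<phi>' ?p (q - ?p)) + norm (\<phi>' ?p (q - ?p))"
      by (metis norm_triangle_sub add.commute)
    also have "\<dots> \<le> norm (q - ?p) + norm (\<phi>' ?p) * norm (q - ?p)"
      using d4(2)[of q] True norm_blinfun[of "\<phi>' ?p" "q - ?p"] \<phi>_\<psi>[OF u0(1)]
      by (intro add_mono) (auto simp: \<delta>_def h_def)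
    finally have hL: "norm h \<le> L * norm (q - ?p)" by (simp add: L_def algebra_simps)
    also have "\<dots> < \<rho>"
    proof -
      have "norm (q - ?p) < \<rho> / L" using True by (simp add: \<delta>_def)
      then show ?thesis using L by (simp add: field_simps)
    qed
    finally have "u0 + h \<in> ball u0 \<rho>" by (simp add: dist_norm)
    then have seg: "closed_segment u0 (u0 + h) \<subseteq> ball u0 \<rho>"
      using \<rho>(1) by (intro closed_segment_subset) auto
    obtain \<xi> where \<xi>: "\<xi> \<in> closed_segment u0 (u0 + h)"
      "(\<psi> (u0 + h) - \<psi> u0) \<bullet> n = \<psi>' u0 h \<bullet> n + (\<psi>'' \<xi> h h \<bullet> n) / 2"
      using Taylor_inner[OF order_trans[OF seg \<rho>(2)]] by blast
    have hS: "h \<in> S" unfolding h_def by (intro subspace_diff subspace_S \<phi>_mem_S qU q u0)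
    have "(q - ?p) \<bullet> n = (\<psi>'' \<xi> h h \<bullet> n) / 2"
      using \<xi>(2) n(2)[OF hS] \<psi>_\<phi>[OF qU] by (simp add: h_def)
    also have "\<dots> \<le> C * (norm h)\<^sup>2 / 2"
    proof -
      have "\<psi>'' \<xi> h h \<bullet> n \<le> norm (\<psi>'' \<xi> h h)" using norm_cauchy_schwarz[of "\<psi>'' \<xi> h h" n] n by simp
      also have "\<dots> \<le> norm (\<psi>'' \<xi>) * (norm h)\<^sup>2" by (rule norm_\<psi>''_le)
      also have "\<dots> \<le> C * (norm h)\<^sup>2" using \<rho>(3) \<xi>(1) seg by (intro mult_right_mono) auto
      finally show ?thesis by simp
    qed
    also have "\<dots> \<le> C * (L * norm (q - ?p))\<^sup>2 / 2"
      using C hL by (intro divide_right_mono mult_left_mono power_mono) auto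
    also have "\<dots> = C * L\<^sup>2 * (norm (q - ?p))\<^sup>2 / 2" by (simp add: power_mult_distrib)
    finally have "2 * s * ((q - ?p) \<bullet> n) \<le> 2 * s * (C * L\<^sup>2 * (norm (q - ?p))\<^sup>2 / 2)"
      using s by (intro mult_left_mono) auto
    also have "\<dots> = (s * (C * L\<^sup>2)) * (norm (q - ?p))\<^sup>2" by simp
    also have "\<dots> \<le> 1 * (norm (q - ?p))\<^sup>2"
    proof (rule mult_right_mono)
      have "s \<le> 1 / (C * L\<^sup>2)" by (simp add: s_def)
      then show "s * (C * L\<^sup>2) \<le> 1" using CL by (simp add: pos_le_divide_eq)
    qed simp
    finally show ?thesis by simp
  qed
  have "norm (?p - (?p + s *\<^sub>R n)) \<le> norm (q - (?p + s *\<^sub>R n))" if "q \<in> M" for q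
  proof (rule power2_le_imp_le)
    have eq: "q - (?p + s *\<^sub>R n) = (q - ?p) - s *\<^sub>R n" by simp
    have "(norm (q - (?p + s *\<^sub>R n)))\<^sup>2 = (norm (q - ?p))\<^sup>2 - 2 * s * ((q - ?p) \<bullet> n) + s\<^sup>2 * (n \<bullet> n)"
      unfolding eq power2_norm_eq_inner
      by (simp add: inner_diff_left inner_diff_right inner_commute power2_eq_square algebra_simps)
    then show "(norm (?p - (?p + s *\<^sub>R n)))\<^sup>2 \<le> (norm (q - (?p + s *\<^sub>R n)))\<^sup>2"
      using key[OF that] n(1) s by (simp add: dot_square_norm)
  qed simp
  then have "?p \<in> nearest_points M (?p + s *\<^sub>R n)"
    using \<psi>_mem_M[OF u0] by (simp add: nearest_points_iff)
  then show ?thesis using s by blast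
qed

section \<open>Geodesics with prescribed initial velocity\<close>

text \<open>The geodesic equation in the chart is \<open>u'' = spray u u'\<close>: the spray is the tangential correction
  that makes the acceleration of \<open>\<psi> \<circ> u\<close> normal. In terms of Christoffel symbols it is
  \<open>- \<Gamma>(v, v)\<close> for \<open>u, v \<in> S\<close>.\<close>

definition spray :: "'a \<Rightarrow> 'a \<Rightarrow> 'a" where
  "spray u v = (THE w. w \<in> S \<and> (\<forall>s\<in>S. (\<psi>'' u v v + \<psi>' u w) \<bullet> \<psi>' u s = 0))"

lemma spray_unique:
  assumes u: "u \<in> V"
    and w: "w \<in> S" "\<And>s. s \<in> S \<Longrightarrow> (b + \<psi>' u w) \<bullet> \<psi>' u s = 0"
    and w': "w' \<in> S" "\<And>s. s \<in> S \<Longrightarrow> (b + \<psi>' u w') \<bullet> \<psi>' u s = 0"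
  shows "w = w'"
proof -
  have d: "w - w' \<in> S" using subspace_S w(1) w'(1) by (rule subspace_diff)
  have "\<psi>' u (w - w') \<bullet> \<psi>' u (w - w') = 0"
    using w(2)[OF d] w'(2)[OF d] by (simp add: blinfun.diff_right inner_diff_left inner_add_left)
  then have "\<psi>' u (w - w') = 0" by simp
  then have "w - w' = 0" using \<phi>'_\<psi>'[OF u, of "w - w'"] by simp
  then show ?thesis by simp
qed

lemma spray_exists:
  obtains w where "w \<in> S" "\<And>s. s \<in> S \<Longrightarrow> (b + \<psi>' u w) \<bullet> \<psi>' u s = 0"
proof -
  obtain y z where y: "y \<in> span (blinfun_apply (\<psi>' u) ` S)"
    and z: "\<And>w. w \<in> span (blinfun_apply (\<psi>' u) ` S) \<Longrightarrow> orthogonal z w" and b: "b = y + z"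
    using orthogonal_subspace_decomp_exists by blast
  have "subspace (blinfun_apply (\<psi>' u) ` S)"
    by (intro linear_subspace_image subspace_S bounded_linear.linear blinfun.bounded_linear_right)
  then obtain s0 where s0: "s0 \<in> S" "y = \<psi>' u s0"
    using y by (auto simp: span_eq_iff[THEN iffD2])
  show thesis
  proof (rule that[of "- s0"])
    show "- s0 \<in> S" using subspace_S s0(1) by (rule subspace_neg)
    fix s assume "s \<in> S"
    then have "orthogonal z (\<psi>' u s)" by (intro z span_base) auto
    then show "(b + \<psi>' u (- s0)) \<bullet> \<psi>' u s = 0"
      using b s0(2) by (simp add: orthogonal_def blinfun.minus_right)
  qed
qed

lemma spray:
  assumes "u \<in> V"
  shows spray_mem: "spray u v \<in> S"
    and spray_orth: "s \<in> S \<Longrightarrow> (\<psi>'' u v v + \<psi>' u (spray u v)) \<bullet> \<psi>' u s = 0"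
proof -
  obtain w where w: "w \<in> S" "\<And>s. s \<in> S \<Longrightarrow> (\<psi>'' u v v + \<psi>' u w) \<bullet> \<psi>' u s = 0"
    using spray_exists[of "\<psi>'' u v v" u] by blast
  have "spray u v \<in> S \<and> (\<forall>s\<in>S. (\<psi>'' u v v + \<psi>' u (spray u v)) \<bullet> \<psi>' u s = 0)"
    unfolding spray_def
  proof (rule theI)
    show "w \<in> S \<and> (\<forall>s\<in>S. (\<psi>'' u v v + \<psi>' u w) \<bullet> \<psi>' u s = 0)" using w by blast
    fix w' assume "w' \<in> S \<and> (\<forall>s\<in>S. (\<psi>'' u v v + \<psi>' u w') \<bullet> \<psi>' u s = 0)"
    then show "w' = w" using w by (intro spray_unique[OF assms, of w' "\<psi>'' u v v" w]) auto
  qed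
  then show "spray u v \<in> S" "s \<in> S \<Longrightarrow> (\<psi>'' u v v + \<psi>' u (spray u v)) \<bullet> \<psi>' u s = 0"
    by auto
qed

lemma norm_spray_le:
  assumes u: "u \<in> V"
  shows "norm (spray u v) \<le> norm (\<phi>' (\<psi> u)) * norm (\<psi>'' u v v)"
proof -
  let ?b = "\<psi>'' u v v" and ?y = "\<psi>' u (spray u v)"
  have "?y \<bullet> ?y = - (?b \<bullet> ?y)"
    using spray_orth[OF u spray_mem[OF u, of v], of v] by (simp add: inner_add_left)
  also have "\<dots> \<le> norm ?b * norm ?y"
    using norm_cauchy_schwarz[of "- ?b" ?y] by simp
  finally have "norm ?y * norm ?y \<le> norm ?b * norm ?y"
    by (simp add: power2_norm_eq_inner flip: power2_eq_square)
  then have "norm ?y \<le> norm ?b"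
    by (cases "norm ?y = 0") (auto simp: mult_le_cancel_right)
  then have "norm (\<phi>' (\<psi> u)) * norm ?y \<le> norm (\<phi>' (\<psi> u)) * norm ?b"
    by (rule mult_left_mono) simp
  moreover have "norm (spray u v) \<le> norm (\<phi>' (\<psi> u)) * norm ?y"
    using norm_blinfun[of "\<phi>' (\<psi> u)" ?y] \<phi>'_\<psi>'[OF u] by simp
  ultimately show ?thesis by linarith
qed

text \<open>The spray is characterized by closed conditions and locally bounded, hence continuous.\<close>

lemma continuous_on_spray:
  fixes K :: "('a \<times> 'a) set"
  assumes K: "compact K" and KV: "\<And>x. x \<in> K \<Longrightarrow> fst x \<in> V"
  shows "continuous_on K (\<lambda>x. spray (fst x) (snd x))"
proof -
  have c\<psi>'': "continuous_on K (\<lambda>x. \<psi>'' (fst x) (snd x) (snd x))"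
    by (intro blinfun.continuous_on continuous_on_compose2[OF \<psi>''_cont] continuous_intros) (use KV in auto)
  have "continuous_on K (\<lambda>x. \<phi>' (\<psi> (fst x)))"
    by (intro continuous_on_compose2[OF \<phi>'_cont] continuous_on_compose2[OF \<psi>_cont] continuous_intros)
      (use KV \<psi>_mem in auto)
  then have "continuous_on K (\<lambda>x. norm (\<phi>' (\<psi> (fst x))) * norm (\<psi>'' (fst x) (snd x) (snd x)))"
    by (intro continuous_intros c\<psi>'')
  then have "bounded ((\<lambda>x. norm (\<phi>' (\<psi> (fst x))) * norm (\<psi>'' (fst x) (snd x) (snd x))) ` K)"
    using K compact_continuous_image compact_imp_bounded by blast
  then obtain C where C: "\<And>x. x \<in> K \<Longrightarrow> norm (\<phi>' (\<psi> (fst x))) * norm (\<psi>'' (fst x) (snd x) (snd x)) \<le> C"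
    by (force simp: bounded_iff)
  show ?thesis
  proof (rule continuous_from_closed_graph[of "cball 0 C"])
    show "(\<lambda>x. spray (fst x) (snd x)) \<in> K \<rightarrow> cball 0 C"
      using C norm_spray_le[OF KV] by (fastforce intro: order_trans)
    define f where "f = (\<lambda>s (y :: ('a \<times> 'a) \<times> 'a).
      (\<psi>'' (fst (fst y)) (snd (fst y)) (snd (fst y)) + \<psi>' (fst (fst y)) (snd y)) \<bullet> \<psi>' (fst (fst y)) s)"
    have eq: "(\<lambda>x. (x, spray (fst x) (snd x))) ` K
        = (K \<times> S) \<inter> (\<Inter>s\<in>S. {y \<in> K \<times> UNIV. f s y = 0})" (is "?L = ?R")
    proof (intro equalityI subsetI)
      fix y assume "y \<in> ?L"
      then show "y \<in> ?R" using spray_mem[OF KV] spray_orth[OF KV] by (auto simp: f_def)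
    next
      fix y assume y: "y \<in> ?R"
      then have K: "fst y \<in> K" and S: "snd y \<in> S" by auto
      have "snd y = spray (fst (fst y)) (snd (fst y))"
        using y by (intro spray_unique[OF KV[OF K] S _ spray_mem[OF KV[OF K]] spray_orth[OF KV[OF K]]])
          (auto simp: f_def)
      then show "y \<in> ?L" by (intro image_eqI[OF _ K]) (simp add: prod_eq_iff)
    qed
    have "continuous_on (K \<times> UNIV) (f s)" for s
      unfolding f_def
      by (intro continuous_intros blinfun.continuous_on continuous_on_compose2[OF \<psi>''_cont]
          continuous_on_compose2[OF \<psi>'_cont]) (use KV in auto)
    then have "closed {y \<in> K \<times> UNIV. f s y = 0}" for s
      using K compact_imp_closed by (intro continuous_closed_preimage_constant closed_Times) auto
    then show "closed ((\<lambda>x. (x, spray (fst x) (snd x))) ` K)"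
      unfolding eq using K compact_imp_closed closed_subspace[OF subspace_S]
      by (intro closed_Int closed_Times closed_INT) auto
  qed simp
qed

text \<open>Peano's theorem solves the second-order equation as a first-order system for \<open>(u, v)\<close> in the ambient
  space. Velocity and position stay in \<open>S\<close> because their derivatives lie there, and the speed is constant
  because the acceleration is normal.\<close>

lemma exists_geodesic:
  assumes u0: "u0 \<in> V" "u0 \<in> S" and v0: "v0 \<in> S" "norm (\<psi>' u0 v0) = 1"
  obtains I \<gamma> w where "0 \<in> I" "arclength_geodesic M I \<gamma>" "\<gamma> 0 = \<psi> u0" "w \<in> S"
    "acceleration \<gamma> 0 = \<psi>'' u0 v0 v0 + \<psi>' u0 w"
    "\<And>s. s \<in> S \<Longrightarrow> acceleration \<gamma> 0 \<bullet> \<psi>' u0 s = 0"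
proof -
  obtain \<rho> where \<rho>: "\<rho> > 0" "cball u0 \<rho> \<subseteq> V" using open_V u0(1) open_contains_cball by blast
  let ?K = "cball (u0, v0) \<rho>"
  have KV: "fst x \<in> V" if "x \<in> ?K" for x
  proof -
    have "dist u0 (fst x) \<le> dist (u0, v0) x" using dist_fst_le[of "(u0, v0)" x] by simp
    then show ?thesis using that \<rho>(2) by auto
  qed
  have "continuous_on ?K (\<lambda>x. (snd x, spray (fst x) (snd x)))"
    by (intro continuous_on_Pair continuous_intros continuous_on_spray) (use KV in auto)
  from Peano_existence[OF this \<rho>(1)]
  obtain e y where e: "0 < e" and y0: "y 0 = (u0, v0)"
    and yK: "\<And>t. t \<in> {-e<..<e} \<Longrightarrow> y t \<in> ?K"
    and y': "\<And>t. t \<in> {-e<..<e} \<Longrightarrow>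
        (y has_vector_derivative (snd (y t), spray (fst (y t)) (snd (y t)))) (at t)"
    by metis
  define I where "I = {-e<..<e}"
  define u where "u = (\<lambda>t. fst (y t))"
  define v where "v = (\<lambda>t. snd (y t))"
  have I: "open I" "0 \<in> I" "is_interval I" using e by (auto simp: I_def is_interval_oo)
  have u': "(u has_vector_derivative v t) (at t)" if "t \<in> I" for t
    using bounded_linear.has_vector_derivative[OF bounded_linear_fst y'[OF that[unfolded I_def]]]
    by (simp add: u_def v_def)
  have v': "(v has_vector_derivative spray (u t) (v t)) (at t)" if "t \<in> I" for t
    using bounded_linear.has_vector_derivative[OF bounded_linear_snd y'[OF that[unfolded I_def]]]
    by (simp add: u_def v_def)
  have uV: "u t \<in> V" if "t \<in> I" for t
    using KV yK that by (simp add: u_def I_def)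
  have vS: "v t \<in> S" if "t \<in> I" for t
    using curve_in_subspace[OF subspace_S e, of v "\<lambda>t. spray (u t) (v t)" t]
      v' spray_mem[OF uV] v0(1) y0 that by (simp add: I_def v_def)
  have uS: "u t \<in> S" if "t \<in> I" for t
    using curve_in_subspace[OF subspace_S e, of u v t]
      u' vS u0(2) y0 that by (simp add: I_def u_def)
  have uv0: "u 0 = u0" "v 0 = v0" by (simp_all add: u_def v_def y0)
  define \<gamma> where "\<gamma> = (\<lambda>t. \<psi> (u t))"
  define a where "a = (\<lambda>t. \<psi>'' (u t) (v t) (v t) + \<psi>' (u t) (spray (u t) (v t)))"
  have d1: "(\<gamma> has_vector_derivative \<psi>' (u t) (v t)) (at t)" if "t \<in> I" for t
    using has_derivative_compose[OF u'[OF that, unfolded has_vector_derivative_def] \<psi>_deriv[OF uV[OF that]]]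
    by (simp add: \<gamma>_def has_vector_derivative_def blinfun.scaleR_right)
  have vel: "velocity \<gamma> t = \<psi>' (u t) (v t)" if "t \<in> I" for t
    unfolding velocity_def by (rule vector_derivative_at[OF d1[OF that]])
  have d2: "(velocity \<gamma> has_vector_derivative a t) (at t)" if t: "t \<in> I" for t
  proof (rule has_vector_derivative_transform_within_open[OF _ I(1) t])
    have "((\<lambda>t. \<psi>' (u t)) has_vector_derivative \<psi>'' (u t) (v t)) (at t)"
      using has_derivative_compose[OF u'[OF t, unfolded has_vector_derivative_def] \<psi>'_deriv[OF uV[OF t]]]
      by (simp add: has_vector_derivative_def blinfun.scaleR_right)
    from blinfun.has_vector_derivative[OF this v'[OF t]]
    show "((\<lambda>t. \<psi>' (u t) (v t)) has_vector_derivative a t) (at t)"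
      by (simp add: a_def add.commute)
  qed (simp add: vel)
  have acc: "acceleration \<gamma> t = a t" if "t \<in> I" for t
    unfolding acceleration_def by (rule vector_derivative_at[OF d2[OF that]])
  have orth: "a t \<bullet> \<psi>' (u t) s = 0" if "t \<in> I" "s \<in> S" for t s
    unfolding a_def by (rule spray_orth[OF uV[OF that(1)] that(2)])
  have inM: "\<gamma> t \<in> M" if "t \<in> I" for t
    unfolding \<gamma>_def by (intro \<psi>_mem_M uV uS that)
  have speed: "norm (velocity \<gamma> t) = 1" if t: "t \<in> I" for t
  proof -
    have "((\<lambda>t. velocity \<gamma> t \<bullet> velocity \<gamma> t) has_derivative (\<lambda>h. 0)) (at s within I)" if s: "s \<in> I" for s
    proof -
      have "((\<lambda>t. velocity \<gamma> t \<bullet> velocity \<gamma> t) has_vector_derivative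
          velocity \<gamma> s \<bullet> a s + a s \<bullet> velocity \<gamma> s) (at s)"
        by (rule bounded_bilinear.has_vector_derivative[OF bounded_bilinear_inner d2[OF s] d2[OF s]])
      moreover have "a s \<bullet> velocity \<gamma> s = 0" using vel[OF s] orth[OF s vS[OF s]] by simp
      ultimately show ?thesis
        by (auto simp: has_vector_derivative_def inner_commute intro: has_derivative_at_withinI)
    qed
    then have "velocity \<gamma> t \<bullet> velocity \<gamma> t = velocity \<gamma> 0 \<bullet> velocity \<gamma> 0"
      using has_derivative_zero_unique[of I "\<lambda>t. velocity \<gamma> t \<bullet> velocity \<gamma> t" t 0] t I(2)
      by (auto simp: I_def)
    also have "\<dots> = 1" using vel[OF I(2)] uv0 v0(2) by (simp add: dot_square_norm)
    finally show ?thesis by (simp add: norm_eq_1)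
  qed
  have "arclength_geodesic M I \<gamma>"
    unfolding arclength_geodesic_def
  proof (intro conjI ballI I)
    show "\<gamma> ` I \<subseteq> M" using inM by blast
    fix t assume t: "t \<in> I"
    show "\<gamma> differentiable at t" "velocity \<gamma> differentiable at t"
      using d1[OF t] d2[OF t] by (auto intro: differentiableI_vector)
    show "norm (velocity \<gamma> t) = 1" by (rule speed[OF t])
    show "covariant_acceleration M \<gamma> t = 0"
    proof (rule covariant_acceleration_eq_0[of \<gamma> t M, OF inM[OF t]])
      fix x assume "x \<in> tangent_space M (\<gamma> t)"
      then show "acceleration \<gamma> t \<bullet> x = 0"
        using tangent_space_eq[OF uV[OF t] uS[OF t]] orth[OF t] acc[OF t] by (auto simp: \<gamma>_def)
    qed
  next
    have cu: "continuous_on I u" and cv: "continuous_on I v"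
      using u' v' by (meson continuous_at_imp_continuous_on has_vector_derivative_continuous)+
    have "continuous_on I (\<lambda>t. spray (fst (u t, v t)) (snd (u t, v t)))"
    proof (rule continuous_on_compose2[OF continuous_on_spray[of ?K]])
      show "(\<lambda>t. (u t, v t)) ` I \<subseteq> ?K" using yK by (auto simp: u_def v_def I_def)
    qed (use KV in \<open>auto intro!: continuous_intros cu cv\<close>)
    then have "continuous_on I a"
      unfolding a_def
      by (intro continuous_intros blinfun.continuous_on continuous_on_compose2[OF \<psi>''_cont cu]
          continuous_on_compose2[OF \<psi>'_cont cu] cv) (use uV in auto)
    then show "continuous_on I (acceleration \<gamma>)"
      using acc by (simp cong: continuous_on_cong)
  qed
  then show thesis
  proof (rule that[OF I(2)])
    show "\<gamma> 0 = \<psi> u0" by (simp add: \<gamma>_def uv0)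
    show "spray u0 v0 \<in> S" by (rule spray_mem[OF u0(1)])
    show "acceleration \<gamma> 0 = \<psi>'' u0 v0 v0 + \<psi>' u0 (spray u0 v0)"
      using acc[OF I(2)] by (simp add: a_def uv0)
    show "acceleration \<gamma> 0 \<bullet> \<psi>' u0 s = 0" if "s \<in> S" for s
      using acc[OF I(2)] orth[OF I(2) that] by (simp add: uv0)
  qed
qed

section \<open>Merging nearest points reveal curvature\<close>

text \<open>If \<open>p\<^sub>n\<close> and \<open>q\<^sub>n\<close> are equidistant from \<open>z\<^sub>n\<close> then \<open>2 (q\<^sub>n - p\<^sub>n) \<bullet> (z\<^sub>n - p\<^sub>n)\<close> is the
  squared norm of \<open>q\<^sub>n - p\<^sub>n\<close>. The first-order term on the left vanishes, since \<open>z\<^sub>n - p\<^sub>n\<close> is normal,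
  and both sides become quadratic in \<open>q\<^sub>n - p\<^sub>n\<close>; the limit direction \<open>h\<close> carries the resulting identity.\<close>

lemma merging_nearest_points:
  fixes p q z :: "nat \<Rightarrow> 'a"
  assumes pq: "\<And>n. p n \<in> nearest_points M (z n)" "\<And>n. q n \<in> nearest_points M (z n)"
    and ne: "\<And>n. p n \<noteq> q n"
    and lim: "p \<longlonglongrightarrow> p0" "q \<longlonglongrightarrow> p0" "z \<longlonglongrightarrow> z0" and p0: "p0 \<in> U"
  obtains h where "h \<in> S" "h \<noteq> 0" "\<psi>'' (\<phi> p0) h h \<bullet> (z0 - p0) = (norm (\<psi>' (\<phi> p0) h))\<^sup>2"
proof -
  define u0 where "u0 = \<phi> p0"
  have u0: "u0 \<in> V" using \<phi>_mem[OF p0] by (simp add: u0_def)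
  define u where "u = (\<lambda>n. \<phi> (p n))"
  define w where "w = (\<lambda>n. \<phi> (q n))"
  define k where "k = (\<lambda>n. (1 / norm (w n - u n)) *\<^sub>R (w n - u n))"
  have "isCont \<phi> p0" using \<phi>_cont open_U p0 continuous_on_eq_continuous_at by blast
  then have ulim: "u \<longlonglongrightarrow> u0" and wlim: "w \<longlonglongrightarrow> u0"
    using lim unfolding u_def w_def u0_def by (auto intro: isCont_tendsto_compose)
  obtain \<rho>1 where \<rho>1: "\<rho>1 > 0" "ball u0 \<rho>1 \<subseteq> V" using open_V u0 open_contains_ball by blast
  have c\<psi>'': "isCont \<psi>'' u0" and c\<psi>': "isCont \<psi>' u0"
    using \<psi>''_cont \<psi>'_cont open_V u0 continuous_on_eq_continuous_at by blast+
  obtain \<rho>2 where \<rho>2: "\<rho>2 > 0" "\<And>\<xi>. dist \<xi> u0 < \<rho>2 \<Longrightarrow> dist (\<psi>'' \<xi>) (\<psi>'' u0) < 1"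
    using c\<psi>'' unfolding continuous_at_eps_delta by (metis zero_less_one)
  define \<rho> where "\<rho> = min \<rho>1 \<rho>2"
  define C where "C = norm (\<psi>'' u0) + 1"
  have \<rho>: "\<rho> > 0" "ball u0 \<rho> \<subseteq> V" using \<rho>1 \<rho>2 by (auto simp: \<rho>_def)
  have C: "norm (\<psi>'' \<xi>) \<le> C" if "\<xi> \<in> ball u0 \<rho>" for \<xi>
  proof -
    have "norm (\<psi>'' \<xi> - \<psi>'' u0) < 1"
      using \<rho>2(2)[of \<xi>] that by (simp add: \<rho>_def dist_norm norm_minus_commute)
    then show ?thesis
      using norm_triangle_sub[of "\<psi>'' \<xi>" "\<psi>'' u0"] by (simp add: C_def)
  qed
  \<comment> \<open>The indices for which the chart and the bound \<open>C\<close> apply to \<open>p n\<close> and \<open>q n\<close>.\<close>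
  define good where "good = (\<lambda>n. p n \<in> U \<and> q n \<in> U \<and> u n \<in> ball u0 \<rho> \<and> w n \<in> ball u0 \<rho>)"
  have ev: "\<forall>\<^sub>F n in sequentially. good n"
    unfolding good_def
    using topological_tendstoD[OF lim(1) open_U p0] topological_tendstoD[OF lim(2) open_U p0]
      topological_tendstoD[OF ulim open_ball, of u0 \<rho>] topological_tendstoD[OF wlim open_ball, of u0 \<rho>] \<rho>(1)
    by (simp add: eventually_conj)
  have seg: "closed_segment (u n) (w n) \<subseteq> ball u0 \<rho>" if "good n" for n
    using that by (intro closed_segment_subset) (auto simp: good_def)
  have mem: "p n \<in> M" "q n \<in> M" for n using pq by (auto simp: nearest_points_def)
  have \<psi>uw: "\<psi> (u n) = p n" "\<psi> (w n) = q n" if "good n" for n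
    using that by (auto simp: good_def u_def w_def \<psi>_\<phi>)
  have uwne: "norm (w n - u n) > 0" if "good n" for n
    using \<psi>uw[OF that] ne[of n] by auto
  have uS: "u n \<in> S" "w n \<in> S" if "good n" for n
    using that mem by (auto simp: good_def u_def w_def intro: \<phi>_mem_S)
  have uV: "u n \<in> V" if "good n" for n
    using that \<rho>(2) by (auto simp: good_def)
  have hS: "w n - u n \<in> S" if "good n" for n
    using subspace_S uS[OF that] by (auto intro: subspace_diff)
  have "\<exists>\<xi>. good n \<longrightarrow> \<xi> \<in> closed_segment (u n) (w n) \<and>
      \<psi>'' \<xi> (k n) (k n) \<bullet> (z n - p n) = (norm ((1 / norm (w n - u n)) *\<^sub>R (q n - p n)))\<^sup>2" for n
  proof (cases "good n")
    case g: True
    let ?h = "w n - u n"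
    have uh: "u n + ?h = w n" by simp
    have "closed_segment (u n) (u n + ?h) \<subseteq> V"
      unfolding uh using seg[OF g] \<rho>(2) by (rule order_trans)
    from Taylor_inner[OF this, of "z n - p n", unfolded uh]
    obtain \<xi> where \<xi>: "\<xi> \<in> closed_segment (u n) (w n)"
      "(\<psi> (w n) - \<psi> (u n)) \<bullet> (z n - p n)
        = \<psi>' (u n) ?h \<bullet> (z n - p n) + (\<psi>'' \<xi> ?h ?h \<bullet> (z n - p n)) / 2"
      by blast
    have "\<psi>' (u n) ?h \<in> tangent_space M (p n)"
      using tangent_space_eq[OF uV[OF g] uS(1)[OF g]] hS[OF g] \<psi>uw(1)[OF g] by simp
    then have "\<psi>' (u n) ?h \<bullet> (z n - p n) = 0"
      using nearest_point_orthogonal[OF pq(1)[of n]] by (metis inner_commute)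
    then have eq1: "2 * ((q n - p n) \<bullet> (z n - p n)) = \<psi>'' \<xi> ?h ?h \<bullet> (z n - p n)"
      using \<xi>(2) \<psi>uw[OF g] by simp
    have "norm (p n - z n) = norm (q n - z n)"
      using pq[of n] by (simp add: nearest_points_def)
    then have "(p n - z n) \<bullet> (p n - z n) = (q n - z n) \<bullet> (q n - z n)"
      by (simp add: norm_eq)
    then have eq2: "2 * ((q n - p n) \<bullet> (z n - p n)) = (norm (q n - p n))\<^sup>2"
      unfolding power2_norm_eq_inner
      by (simp add: inner_diff_left inner_diff_right inner_commute algebra_simps)
    have "\<psi>'' \<xi> (k n) (k n) \<bullet> (z n - p n) = (1 / norm ?h)\<^sup>2 * (\<psi>'' \<xi> ?h ?h \<bullet> (z n - p n))"
      by (simp add: k_def blinfun.scaleR_right blinfun.scaleR_left power2_eq_square)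
    also have "\<dots> = (norm ((1 / norm ?h) *\<^sub>R (q n - p n)))\<^sup>2"
      using eq1 eq2 by (simp add: power_mult_distrib power_divide)
    finally show ?thesis using \<xi>(1) by blast
  qed simp
  then obtain \<xi> where \<xi>: "\<And>n. good n \<Longrightarrow> \<xi> n \<in> closed_segment (u n) (w n)"
      "\<And>n. good n \<Longrightarrow> \<psi>'' (\<xi> n) (k n) (k n) \<bullet> (z n - p n)
        = (norm ((1 / norm (w n - u n)) *\<^sub>R (q n - p n)))\<^sup>2"
    by metis
  have \<xi>lim: "\<xi> \<longlonglongrightarrow> u0"
  proof (rule Lim_null_comparison[THEN LIM_zero_cancel])
    show "(\<lambda>n. norm (u n - u0) + norm (w n - u0)) \<longlonglongrightarrow> 0"
      using tendsto_add[OF tendsto_norm[OF LIM_zero[OF ulim]] tendsto_norm[OF LIM_zero[OF wlim]]] by simp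
    show "\<forall>\<^sub>F n in sequentially. norm (\<xi> n - u0) \<le> norm (u n - u0) + norm (w n - u0)"
      using ev
    proof eventually_elim
      case (elim n)
      have "\<xi> n \<in> cball u0 (max (norm (u n - u0)) (norm (w n - u0)))"
        by (rule subsetD[OF closed_segment_subset \<xi>(1)[OF elim]]) (auto simp: dist_norm norm_minus_commute)
      then show ?case by (auto simp: dist_norm norm_minus_commute max_def split: if_splits)
        (smt (verit) norm_ge_zero)+
    qed
  qed
  obtain r h where r: "strict_mono r" and h: "(\<lambda>n. k (r n)) \<longlonglongrightarrow> h"
  proof -
    have "\<forall>n. k n \<in> cball 0 1" by (simp add: k_def)
    then obtain h r where "strict_mono r" "(k \<circ> r) \<longlonglongrightarrow> h"
      using compact_imp_seq_compact[OF compact_cball] unfolding seq_compact_def by blast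
    then show thesis by (intro that[of r h]) (simp_all add: comp_def)
  qed
  have evr: "\<forall>\<^sub>F n in sequentially. good (r n)"
    by (rule eventually_subseq[OF r ev])
  note subs = LIMSEQ_subseq_LIMSEQ[OF _ r, unfolded comp_def]
  have hn: "norm h = 1"
  proof (rule LIMSEQ_unique[OF tendsto_norm[OF h]])
    show "(\<lambda>n. norm (k (r n))) \<longlonglongrightarrow> 1"
    proof (rule tendsto_eventually)
      show "\<forall>\<^sub>F n in sequentially. norm (k (r n)) = 1"
        using evr by eventually_elim (use uwne in \<open>force simp: k_def\<close>)
    qed
  qed
  have "h \<in> S"
  proof (rule Lim_in_closed_set[OF closed_subspace[OF subspace_S] _ _ h])
    show "\<forall>\<^sub>F n in sequentially. k (r n) \<in> S"
      using evr by eventually_elim (auto simp: k_def intro!: subspace_scale[OF subspace_S] hS)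
  qed simp
  \<comment> \<open>Both sides of the identity, divided by the squared length of \<open>w n - u n\<close>, converge along the
    subsequence of the normalized directions \<open>k\<close>.\<close>
  have L1: "(\<lambda>n. \<psi>'' (\<xi> (r n)) (k (r n)) (k (r n)) \<bullet> (z (r n) - p (r n))) \<longlonglongrightarrow> \<psi>'' u0 h h \<bullet> (z0 - p0)"
    by (intro tendsto_inner blinfun.tendsto isCont_tendsto_compose[OF c\<psi>''] tendsto_diff h
        subs[OF \<xi>lim] subs[OF lim(1)] subs[OF lim(3)])
  have L2: "(\<lambda>n. (1 / norm (w (r n) - u (r n))) *\<^sub>R (q (r n) - p (r n))) \<longlonglongrightarrow> \<psi>' u0 h"
  proof -
    have "(\<lambda>n. \<psi>' (u (r n)) (k (r n))) \<longlonglongrightarrow> \<psi>' u0 h"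
      by (intro blinfun.tendsto isCont_tendsto_compose[OF c\<psi>'] h subs[OF ulim])
    moreover have "(\<lambda>n. (1 / norm (w (r n) - u (r n))) *\<^sub>R (q (r n) - p (r n)) - \<psi>' (u (r n)) (k (r n))) \<longlonglongrightarrow> 0"
    proof (rule Lim_null_comparison)
      have "(\<lambda>n. C * norm (w (r n) - u (r n))) \<longlonglongrightarrow> C * norm (u0 - u0)"
        by (intro tendsto_intros subs[OF ulim] subs[OF wlim])
      then show "(\<lambda>n. C * norm (w (r n) - u (r n))) \<longlonglongrightarrow> 0" by simp
      show "\<forall>\<^sub>F n in sequentially. norm ((1 / norm (w (r n) - u (r n))) *\<^sub>R (q (r n) - p (r n))
          - \<psi>' (u (r n)) (k (r n))) \<le> C * norm (w (r n) - u (r n))"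
        using evr
      proof eventually_elim
        case (elim n)
        let ?m = "r n"
        let ?h = "w ?m - u ?m"
        have "norm (\<psi> (u ?m + ?h) - \<psi> (u ?m) - \<psi>' (u ?m) ?h) \<le> C * (norm ?h)\<^sup>2"
          using seg[OF elim] \<rho>(2) C by (intro Taylor_norm) auto
        then have "norm (q ?m - p ?m - \<psi>' (u ?m) ?h) \<le> C * (norm ?h)\<^sup>2"
          using \<psi>uw[OF elim] by simp
        then have "(1 / norm ?h) * norm (q ?m - p ?m - \<psi>' (u ?m) ?h) \<le> (1 / norm ?h) * (C * (norm ?h)\<^sup>2)"
          by (intro mult_left_mono) auto
        also have "\<dots> = C * norm ?h" using uwne[OF elim] by (simp add: power2_eq_square)
        finally have "norm ((1 / norm ?h) *\<^sub>R (q ?m - p ?m - \<psi>' (u ?m) ?h)) \<le> C * norm ?h" by simp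
        then show ?case by (simp only: k_def blinfun.scaleR_right blinfun.diff_right scaleR_diff_right)
      qed
    qed
    ultimately show ?thesis using tendsto_add by fastforce
  qed
  have "\<psi>'' u0 h h \<bullet> (z0 - p0) = (norm (\<psi>' u0 h))\<^sup>2"
  proof (rule LIMSEQ_unique[OF L1])
    show "(\<lambda>n. \<psi>'' (\<xi> (r n)) (k (r n)) (k (r n)) \<bullet> (z (r n) - p (r n))) \<longlonglongrightarrow> (norm (\<psi>' u0 h))\<^sup>2"
      by (rule Lim_transform_eventually[OF tendsto_power[OF tendsto_norm[OF L2], of 2]])
        (use evr in \<open>eventually_elim, simp add: \<xi>(2)\<close>)
  qed
  moreover have "h \<noteq> 0" using hn by auto
  ultimately show thesis using that \<open>h \<in> S\<close> unfolding u0_def by blast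
qed

end

section \<open>The reach of a compact submanifold is finite and bounds curvature\<close>

lemma farthest_point_orthogonal:
  assumes p: "p \<in> A" and far: "\<And>a. a \<in> A \<Longrightarrow> norm (a - z) \<le> norm (p - z)"
    and v: "v \<in> tangent_space A p"
  shows "v \<bullet> (z - p) = 0"
proof -
  obtain c e where c: "e > 0" "c ` {-e<..<e} \<subseteq> A" "c 0 = p" "(c has_vector_derivative v) (at (0::real))"
    using v unfolding tangent_space_def by blast
  have "((\<lambda>t. (c t - z) \<bullet> (c t - z)) has_real_derivative 2 * (v \<bullet> (p - z))) (at 0)"
    using c(4) c(3) unfolding has_vector_derivative_def has_field_derivative_def
    by (auto intro!: derivative_eq_intros simp: inner_commute algebra_simps)
  then have "2 * (v \<bullet> (p - z)) = 0"
  proof (rule DERIV_local_max[OF _ c(1)], intro allI impI)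
    fix y :: real assume "\<bar>0 - y\<bar> < e"
    then have "c y \<in> A" using c(2) by (auto simp: image_subset_iff abs_less_iff)
    then have "norm (c y - z) \<le> norm (p - z)" by (rule far)
    then show "(c y - z) \<bullet> (c y - z) \<le> (c 0 - z) \<bullet> (c 0 - z)"
      using c(3) by (simp add: norm_le)
  qed
  then show ?thesis by (simp add: inner_diff_right)
qed

lemma tangent_space_singleton: "tangent_space {p} p \<subseteq> {0}"
proof
  fix v assume "v \<in> tangent_space {p} p"
  then obtain c e where c: "e > 0" "c ` {-e<..<e} \<subseteq> {p}" "(c has_vector_derivative v) (at (0::real))"
    unfolding tangent_space_def by blast
  have "(c has_vector_derivative 0) (at 0)"
    by (rule has_vector_derivative_transform_within_open[of "\<lambda>_. p" _ _ "{-e<..<e}"])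
      (use c in \<open>auto simp: image_subset_iff\<close>)
  then show "v \<in> {0}" using vector_derivative_unique_at[OF c(3)] by simp
qed

text \<open>At an end point of a diameter the direction of the other end point is normal. With infinite reach,
  balls of every radius tangent there would miss that other end point.\<close>

lemma reach_finite:
  fixes M :: "'a::euclidean_space set"
  assumes M: "C2_submanifold d M" "compact M" and d: "1 \<le> d"
  shows "reach M \<noteq> \<infinity>"
proof
  assume inf: "reach M = \<infinity>"
  have ne: "M \<noteq> {}" using M(1) by (simp add: C2_submanifold_def)
  obtain p q where pq: "p \<in> M" "q \<in> M" "dist p q = diameter M"
    using diameter_compact_attained[OF M(2) ne] by blast
  have far: "norm (a - q) \<le> norm (p - q)" if "a \<in> M" for a
    using diameter_bounded_bound[OF compact_imp_bounded[OF M(2)] that pq(2)] pq(3)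
    by (simp add: dist_norm)
  obtain U V S \<phi> \<psi> \<phi>' \<psi>' \<psi>'' where chart: "C2_chart M U V S \<phi> \<psi> \<phi>' \<psi>' \<psi>''"
    and pU: "p \<in> U" and dim: "dim S = d"
    by (rule C2_submanifold_chart[OF M(1) pq(1)])
  interpret C2_chart M U V S \<phi> \<psi> \<phi>' \<psi>' \<psi>'' by (rule chart)
  have u: "\<phi> p \<in> V" "\<phi> p \<in> S" and \<psi>p: "\<psi> (\<phi> p) = p"
    using \<phi>_mem \<phi>_mem_S \<psi>_\<phi> pU pq(1) by auto
  have T: "tangent_space M p = blinfun_apply (\<psi>' (\<phi> p)) ` S"
    using tangent_space_eq[OF u] by (simp add: \<psi>p)
  have "p \<noteq> q"
  proof
    assume "p = q"
    have "a = p" if "a \<in> M" for a using far[OF that] \<open>p = q\<close> by simp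
    then have Mp: "M = {p}" using pq(1) by blast
    have "\<not> S \<subseteq> {0}" using dim d dim_eq_0[of S] by auto
    then obtain s where s: "s \<in> S" "s \<noteq> 0" by auto
    then have "\<psi>' (\<phi> p) s \<in> tangent_space M p" by (auto simp: T)
    then have "\<psi>' (\<phi> p) s = 0" using tangent_space_singleton[of p] Mp by auto
    then show False using \<phi>'_\<psi>'[OF u(1), of s] s(2) by simp
  qed
  define n where "n = (1 / norm (q - p)) *\<^sub>R (q - p)"
  have n: "norm n = 1" using \<open>p \<noteq> q\<close> by (simp add: n_def)
  have "\<psi>' (\<phi> p) s \<bullet> n = 0" if "s \<in> S" for s
    using farthest_point_orthogonal[OF pq(1) far, of "\<psi>' (\<phi> p) s"] that by (simp add: n_def T)
  then obtain s where s: "s > 0" "p \<in> nearest_points M (p + s *\<^sub>R n)"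
    using normal_nearest_point[OF u n] \<psi>p by auto
  have "2 * norm (q - p) * ((q - p) \<bullet> n) \<le> (norm (q - p))\<^sup>2"
    using inf by (intro nearest_point_inner_le[OF M(2) s(2,1) n _ _ pq(2)]) auto
  moreover have "(q - p) \<bullet> n = norm (q - p)"
    using \<open>p \<noteq> q\<close> by (simp add: n_def power2_norm_eq_inner[symmetric] power2_eq_square)
  ultimately show False using \<open>p \<noteq> q\<close> by (simp add: power2_eq_square)
qed

text \<open>A geodesic cannot bend faster than the sphere of radius \<open>r\<close> whose interior \<open>M\<close> avoids: compare second
  derivatives at the point of contact.\<close>

lemma acceleration_inner_le:
  fixes M :: "'a::euclidean_space set"
  assumes M: "compact M" and geo: "arclength_geodesic M I \<gamma>" and I0: "0 \<in> I"
    and near: "0 < s" "\<gamma> 0 \<in> nearest_points M (\<gamma> 0 + s *\<^sub>R n)" and n: "norm n = 1"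
    and r: "0 \<le> r" "ereal r \<le> reach M"
  shows "r * (acceleration \<gamma> 0 \<bullet> n) \<le> 1"
proof (rule ccontr)
  assume contr: "\<not> ?thesis"
  have I: "open I" and inM: "\<And>t. t \<in> I \<Longrightarrow> \<gamma> t \<in> M"
    and cont: "continuous_on I (acceleration \<gamma>)" and speed: "\<And>t. t \<in> I \<Longrightarrow> norm (velocity \<gamma> t) = 1"
    using geo unfolding arclength_geodesic_def by auto
  have d1: "(\<gamma> has_vector_derivative velocity \<gamma> t) (at t)"
    and d2: "(velocity \<gamma> has_vector_derivative acceleration \<gamma> t) (at t)" if "t \<in> I" for t
    using geo that unfolding arclength_geodesic_def velocity_def acceleration_def
    by (auto simp: vector_derivative_works)
  define p where "p = \<gamma> 0"
  define g where "g = (\<lambda>(k::nat) t.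
    if k = 0 then (\<gamma> t - p) \<bullet> (\<gamma> t - p) - 2 * r * ((\<gamma> t - p) \<bullet> n)
    else if k = 1 then 2 * (velocity \<gamma> t \<bullet> (\<gamma> t - p)) - 2 * r * (velocity \<gamma> t \<bullet> n)
    else 2 * (acceleration \<gamma> t \<bullet> (\<gamma> t - p)) + 2 - 2 * r * (acceleration \<gamma> t \<bullet> n))"
  have g1: "(g 0 has_real_derivative g 1 t) (at t)" if t: "t \<in> I" for t
    using d1[OF t] unfolding g_def has_vector_derivative_def has_field_derivative_def
    by (auto intro!: derivative_eq_intros simp: inner_commute algebra_simps)
  have g2: "(g 1 has_real_derivative g 2 t) (at t)" if t: "t \<in> I" for t
  proof -
    have "velocity \<gamma> t \<bullet> velocity \<gamma> t = 1" using speed[OF t] by (simp add: dot_square_norm)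
    then show ?thesis
      using d1[OF t] d2[OF t] unfolding g_def has_vector_derivative_def has_field_derivative_def
      by (auto intro!: derivative_eq_intros simp: inner_commute algebra_simps)
  qed
  have "continuous_on I \<gamma>"
    using d1 by (meson continuous_at_imp_continuous_on has_vector_derivative_continuous)
  then have "continuous_on I (g 2)"
    unfolding g_def by (auto intro!: continuous_intros cont)
  then have "isCont (g 2) 0" using I I0 continuous_on_eq_continuous_at by blast
  moreover have "g 2 0 < 0" using contr by (simp add: g_def p_def)
  ultimately have "\<forall>\<^sub>F t in at 0. g 2 t < 0"
    using order_tendstoD(2)[of "g 2" "g 2 0" "at 0" 0] by (simp add: isCont_def)
  then obtain d1 where "d1 > 0" "\<And>t. t \<noteq> 0 \<Longrightarrow> \<bar>t\<bar> < d1 \<Longrightarrow> g 2 t < 0"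
    unfolding eventually_at by (auto simp: dist_real_def)
  moreover obtain d2 where "d2 > 0" "ball 0 d2 \<subseteq> I" using I I0 open_contains_ball by blast
  ultimately obtain \<delta> where \<delta>: "\<delta> > 0" "\<And>t. 0 < t \<Longrightarrow> t \<le> \<delta> \<Longrightarrow> g 2 t < 0" "\<And>t. 0 \<le> t \<Longrightarrow> t \<le> \<delta> \<Longrightarrow> t \<in> I"
  proof (intro that[of "min d1 d2 / 2"])
  qed (auto simp: subset_iff)
  have "\<exists>t>0. t < \<delta> \<and> g 0 \<delta> = (\<Sum>k<2. g k 0 / fact k * \<delta> ^ k) + g 2 t / fact 2 * \<delta> ^ 2"
  proof (rule Maclaurin[OF \<delta>(1)])
    show "\<forall>k t. k < 2 \<and> 0 \<le> t \<and> t \<le> \<delta> \<longrightarrow> (g k has_real_derivative g (Suc k) t) (at t)"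
    proof (intro allI impI)
      fix k :: nat and t :: real assume kt: "k < 2 \<and> 0 \<le> t \<and> t \<le> \<delta>"
      then consider "k = 0" | "k = 1" by linarith
      then show "(g k has_real_derivative g (Suc k) t) (at t)"
        by cases (use kt g1[of t] g2[of t] \<delta>(3)[of t] in \<open>simp_all add: numeral_2_eq_2\<close>)
    qed
  qed auto
  then obtain t where t: "0 < t" "t < \<delta>" and eq: "g 0 \<delta> = g 0 0 + g 1 0 * \<delta> + g 2 t / 2 * \<delta>\<^sup>2"
    by (auto simp: numeral_2_eq_2 lessThan_Suc)
  have orth: "velocity \<gamma> 0 \<bullet> n = 0"
  proof -
    obtain e where e: "e > 0" "ball 0 e \<subseteq> I" using I I0 open_contains_ball by blast
    then have "\<gamma> ` {-e<..<e} \<subseteq> M" using inM by (auto simp: subset_iff)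
    then have "velocity \<gamma> 0 \<in> tangent_space M (\<gamma> 0)"
      unfolding tangent_space_def using d1[OF I0] e(1) by blast
    from nearest_point_orthogonal[OF near(2) this] show ?thesis
      using near(1) by (simp add: inner_commute)
  qed
  have "g 0 0 = 0" "g 1 0 = 0" using orth by (simp_all add: g_def p_def)
  then have "g 0 \<delta> = g 2 t / 2 * \<delta>\<^sup>2" using eq by simp
  also have "\<dots> < 0"
    using \<delta>(1) \<delta>(2)[of t] t by (intro mult_neg_pos) auto
  finally have "g 0 \<delta> < 0" .
  moreover have "2 * r * ((\<gamma> \<delta> - p) \<bullet> n) \<le> (norm (\<gamma> \<delta> - p))\<^sup>2"
    unfolding p_def using \<delta>(1) \<delta>(3)[of \<delta>]
    by (intro nearest_point_inner_le[OF M near(2,1) n r] inM) auto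
  ultimately show False by (simp add: g_def power2_norm_eq_inner)
qed

section \<open>The dichotomy\<close>

text \<open>The medial axis is not closed in general, so the infimum defining the reach is approached along a
  sequence. When \<open>p0\<close> and \<open>q0\<close> coincide, \<open>z0\<close> may fail to lie on the medial axis.\<close>

lemma exists_limit_of_medial_axis:
  fixes M :: "'a::euclidean_space set"
  assumes M: "compact M" and r: "reach M = ereal r"
  obtains p z q :: "nat \<Rightarrow> 'a" and p0 q0 z0 where
    "\<forall>n. p n \<in> nearest_points M (z n) \<and> q n \<in> nearest_points M (z n) \<and> p n \<noteq> q n"
    "p \<longlonglongrightarrow> p0" "q \<longlonglongrightarrow> q0" "z \<longlonglongrightarrow> z0" "infdist z0 M = r"
    "p0 \<in> nearest_points M z0" "q0 \<in> nearest_points M z0"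
proof -
  have "\<exists>z\<in>medial_axis M. infdist z M < r + 1 / real (Suc n)" for n
  proof -
    have "(INF z\<in>medial_axis M. ereal (infdist z M)) < ereal (r + 1 / real (Suc n))"
      using r unfolding reach_def by simp
    then show ?thesis by (auto simp: INF_less_iff)
  qed
  then obtain z where z: "\<And>n. z n \<in> medial_axis M" "\<And>n. infdist (z n) M < r + 1 / real (Suc n)"
    by metis
  have "\<exists>p q. p \<in> nearest_points M (z n) \<and> q \<in> nearest_points M (z n) \<and> p \<noteq> q" for n
    using z(1)[of n] unfolding medial_axis_def nearest_points_def by blast
  then obtain p q where pq: "\<And>n. p n \<in> nearest_points M (z n)" "\<And>n. q n \<in> nearest_points M (z n)"
      "\<And>n. p n \<noteq> q n"
    by metis
  have mem: "p n \<in> M" "q n \<in> M" for n using pq by (auto simp: nearest_points_def)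
  have ge: "r \<le> infdist (z n) M" for n
  proof -
    have "reach M \<le> ereal (infdist (z n) M)" unfolding reach_def by (rule INF_lower[OF z(1)])
    then show ?thesis by (simp add: r)
  qed
  obtain B where B: "\<And>x. x \<in> M \<Longrightarrow> norm x \<le> B"
    using compact_imp_bounded[OF M] by (auto simp: bounded_iff)
  have zB: "z n \<in> cball 0 (B + r + 1)" for n
  proof -
    have "norm (p n - z n) < r + 1 / real (Suc n)"
      using pq(1)[of n] z(2)[of n] by (simp add: nearest_points_def)
    also have "\<dots> \<le> r + 1" by simp
    finally have "norm (p n - z n) < r + 1" .
    moreover have "norm (z n) \<le> norm (p n) + norm (p n - z n)"
      using norm_triangle_sub[of "z n" "p n"] by (simp add: norm_minus_commute)
    ultimately show ?thesis using B[OF mem(1)[of n]] by simp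
  qed
  let ?K = "M \<times> M \<times> cball (0::'a) (B + r + 1)"
  have "compact ?K" by (intro compact_Times M compact_cball)
  note subseq = compact_imp_seq_compact[OF this, unfolded seq_compact_def, rule_format]
  have "\<exists>x\<in>?K. \<exists>k. strict_mono (k :: nat \<Rightarrow> nat) \<and> ((\<lambda>n. (p n, q n, z n)) \<circ> k) \<longlonglongrightarrow> x"
    by (rule subseq) (use mem zB in blast)
  then obtain x k where k: "strict_mono (k :: nat \<Rightarrow> nat)"
    and x: "((\<lambda>n. (p n, q n, z n)) \<circ> k) \<longlonglongrightarrow> x"
    by blast
  define p0 q0 z0 where "p0 = fst x" and "q0 = fst (snd x)" and "z0 = snd (snd x)"
  have lim: "(p \<circ> k) \<longlonglongrightarrow> p0" "(q \<circ> k) \<longlonglongrightarrow> q0" "(z \<circ> k) \<longlonglongrightarrow> z0"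
    using tendsto_fst[OF x] tendsto_fst[OF tendsto_snd[OF x]] tendsto_snd[OF tendsto_snd[OF x]]
    by (simp_all add: comp_def p0_def q0_def z0_def)
  have inf: "(\<lambda>n. infdist ((z \<circ> k) n) M) \<longlonglongrightarrow> infdist z0 M"
    by (rule tendsto_infdist[OF lim(3)])
  have "(\<lambda>n. infdist (z n) M) \<longlonglongrightarrow> r"
  proof (rule tendsto_sandwich)
    show "\<forall>\<^sub>F n in sequentially. r \<le> infdist (z n) M" using ge by simp
    show "\<forall>\<^sub>F n in sequentially. infdist (z n) M \<le> r + 1 / real (Suc n)"
      using z(2) by (simp add: less_imp_le)
    show "(\<lambda>n. r + 1 / real (Suc n)) \<longlonglongrightarrow> r"
      using tendsto_add[OF tendsto_const LIMSEQ_inverse_real_of_nat, of r] by (simp add: inverse_eq_divide)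
  qed simp
  from LIMSEQ_subseq_LIMSEQ[OF this k] inf have infr: "infdist z0 M = r"
    by (simp add: comp_def LIMSEQ_unique)
  have closed: "closed M" using M by (rule compact_imp_closed)
  have near: "a0 \<in> nearest_points M z0"
    if a: "\<And>n. a n \<in> nearest_points M (z n)" and "(a \<circ> k) \<longlonglongrightarrow> a0" for a a0
  proof -
    have "a0 \<in> M"
      by (rule closed_sequentially[OF closed _ that(2)]) (use a in \<open>auto simp: nearest_points_def\<close>)
    moreover have "norm (a0 - z0) = infdist z0 M"
    proof (rule LIMSEQ_unique[OF tendsto_norm[OF tendsto_diff[OF that(2) lim(3)]]])
      show "(\<lambda>n. norm ((a \<circ> k) n - (z \<circ> k) n)) \<longlonglongrightarrow> infdist z0 M"
        using inf a by (simp add: nearest_points_def)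
    qed
    ultimately show ?thesis by (simp add: nearest_points_def)
  qed
  show thesis
    by (rule that[of "p \<circ> k" "z \<circ> k" "q \<circ> k" p0 q0 z0])
      (use pq lim infr near[OF pq(1) lim(1)] near[OF pq(2) lim(2)] in \<open>auto simp: comp_def\<close>)
qed

text \<open>The inner product of the acceleration with \<open>z0 - p0\<close>, a vector of norm \<open>r\<close>, is \<open>1\<close>: the tangential
  correction in the geodesic equation does not contribute. Hence the lower bound \<open>1 / r\<close>; the upper one is the
  curvature bound in the direction of the acceleration itself.\<close>

lemma geodesic_of_merging_nearest_points:
  fixes M :: "'a::euclidean_space set"
  assumes M: "C2_submanifold d M" "compact M" and r: "0 < r" "reach M = ereal r"
    and pq: "\<And>n. p n \<in> nearest_points M (z n)" "\<And>n. q n \<in> nearest_points M (z n)" "\<And>n. p n \<noteq> q n"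
    and lim: "p \<longlonglongrightarrow> p0" "q \<longlonglongrightarrow> p0" "z \<longlonglongrightarrow> z0"
    and z0: "infdist z0 M = r" "p0 \<in> nearest_points M z0"
  shows "\<exists>q0\<in>M. \<exists>I \<gamma>. 0 \<in> I \<and> arclength_geodesic M I \<gamma> \<and> \<gamma> 0 = q0 \<and> norm (acceleration \<gamma> 0) = 1 / r"
proof -
  have p0: "p0 \<in> M" "norm (z0 - p0) = r"
    using z0 by (auto simp: nearest_points_def norm_minus_commute)
  obtain U V S \<phi> \<psi> \<phi>' \<psi>' \<psi>'' where chart: "C2_chart M U V S \<phi> \<psi> \<phi>' \<psi>' \<psi>''" and pU: "p0 \<in> U" and "dim S = d"
    by (rule C2_submanifold_chart[OF M(1) p0(1)])
  interpret C2_chart M U V S \<phi> \<psi> \<phi>' \<psi>' \<psi>'' by (rule chart)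
  define u0 where "u0 = \<phi> p0"
  have u0: "u0 \<in> V" "u0 \<in> S" and \<psi>u0: "\<psi> u0 = p0"
    using \<phi>_mem \<phi>_mem_S \<psi>_\<phi> pU p0(1) by (auto simp: u0_def)
  obtain h where h: "h \<in> S" "h \<noteq> 0" "\<psi>'' u0 h h \<bullet> (z0 - p0) = (norm (\<psi>' u0 h))\<^sup>2"
    using merging_nearest_points[OF pq lim pU] unfolding u0_def by blast
  define L where "L = norm (\<psi>' u0 h)"
  have "\<psi>' u0 h \<noteq> 0" using \<phi>'_\<psi>'[OF u0(1), of h] h(2) by auto
  then have L: "L > 0" by (simp add: L_def)
  define v0 where "v0 = (1 / L) *\<^sub>R h"
  have v0: "v0 \<in> S" "norm (\<psi>' u0 v0) = 1"
    using L subspace_S h(1) by (auto simp: v0_def blinfun.scaleR_right L_def intro: subspace_scale)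
  have curv: "\<psi>'' u0 v0 v0 \<bullet> (z0 - p0) = 1"
    using h(3) L by (simp add: v0_def blinfun.scaleR_right blinfun.scaleR_left L_def[symmetric]
        power2_eq_square)
  obtain I \<gamma> w where geo: "0 \<in> I" "arclength_geodesic M I \<gamma>" "\<gamma> 0 = \<psi> u0" and w: "w \<in> S"
    and acc: "acceleration \<gamma> 0 = \<psi>'' u0 v0 v0 + \<psi>' u0 w"
    and orth: "\<And>s. s \<in> S \<Longrightarrow> acceleration \<gamma> 0 \<bullet> \<psi>' u0 s = 0"
    using exists_geodesic[OF u0 v0] by blast
  let ?a = "acceleration \<gamma> 0"
  have "\<psi>' u0 w \<in> tangent_space M p0"
    using tangent_space_eq[OF u0] w by (simp add: \<psi>u0)
  then have "\<psi>' u0 w \<bullet> (z0 - p0) = 0"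
    using nearest_point_orthogonal[OF z0(2)] by (metis inner_commute)
  then have "?a \<bullet> (z0 - p0) = 1" using curv by (simp add: acc inner_add_left)
  then have lower: "1 \<le> norm ?a * r"
    using norm_cauchy_schwarz[of ?a "z0 - p0"] p0(2) by simp
  then have a0: "?a \<noteq> 0" by auto
  define n where "n = (1 / norm ?a) *\<^sub>R ?a"
  have n: "norm n = 1" "?a \<bullet> n = norm ?a"
    using a0 by (auto simp: n_def power2_norm_eq_inner[symmetric] power2_eq_square)
  have "\<psi>' u0 s \<bullet> n = 0" if "s \<in> S" for s
    using orth[OF that] by (simp add: n_def inner_commute)
  from normal_nearest_point[OF u0 n(1) this]
  obtain s where s: "s > 0" "\<psi> u0 \<in> nearest_points M (\<psi> u0 + s *\<^sub>R n)" by blast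
  have "r * (?a \<bullet> n) \<le> 1"
    by (rule acceleration_inner_le[OF M(2) geo(2,1) s(1) _ n(1)]) (use s(2) geo(3) r in auto)
  then have "norm ?a * r = 1" using lower n(2) by (simp add: mult.commute)
  then have "norm ?a = 1 / r" using r(1) by (simp add: field_simps)
  then show ?thesis using geo p0(1) \<psi>u0 by blast
qed

theorem theorem3p4:
  fixes M :: "'a::euclidean_space set" and d :: nat
  assumes "DIM('a) \<ge> 2"
    and "1 \<le> d" and "d < DIM('a)"
    and "C2_submanifold d M" and "compact M" and "connected M"
    and "reach M > 0"
  shows "(\<exists>q1 q2. bottleneck M q1 q2) \<or>
         (\<exists>q0\<in>M. \<exists>I \<gamma>0. 0 \<in> I \<and> arclength_geodesic M I \<gamma>0 \<and> \<gamma>0 0 = q0 \<and>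
            norm (acceleration \<gamma>0 0) = 1 / real_of_ereal (reach M))"
proof -
  note M = \<open>C2_submanifold d M\<close> \<open>compact M\<close>
  obtain r where reach: "reach M = ereal r" and r: "0 < r"
    using reach_finite[OF M \<open>1 \<le> d\<close>] \<open>reach M > 0\<close> by (cases "reach M") auto
  obtain p z q p0 q0 z0 where
    pq: "\<forall>n. p n \<in> nearest_points M (z n) \<and> q n \<in> nearest_points M (z n) \<and> p n \<noteq> q n"
    and lim: "p \<longlonglongrightarrow> p0" "q \<longlonglongrightarrow> q0" "z \<longlonglongrightarrow> z0" and inf: "infdist z0 M = r"
    and near: "p0 \<in> nearest_points M z0" "q0 \<in> nearest_points M z0"
    by (rule exists_limit_of_medial_axis[OF M(2) reach])
  have mem: "p0 \<in> M" "q0 \<in> M" and sphere: "norm (p0 - z0) = r" "norm (q0 - z0) = r"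
    using near inf by (auto simp: nearest_points_def)
  have avoid: "r \<le> norm (a - z0)" if "a \<in> M" for a
    using infdist_le[OF that, of z0] inf by (simp add: dist_norm norm_minus_commute)
  show ?thesis
  proof (cases "p0 = q0")
    case True
    then show ?thesis
      using geodesic_of_merging_nearest_points[OF M r reach, of p z q p0 z0] pq lim inf near(1) reach by simp
  next
    case ne: False
    show ?thesis
    proof (cases "norm (p0 - q0) = 2 * r")
      case True
      have "z0 \<in> medial_axis M"
        using ne near unfolding medial_axis_def nearest_points_def by blast
      then have "bottleneck M p0 q0"
        unfolding bottleneck_def using mem sphere True reach
        by (auto simp: dist_norm norm_minus_commute)
      then show ?thesis by blast
    next
      case False
      obtain e1 e2 \<theta> where on: "norm e1 = 1" "norm e2 = 1" "e1 \<bullet> e2 = 0" and \<theta>: "0 < \<theta>" "\<theta> < pi"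
        and ends: "circle_arc z0 r e1 e2 0 = p0" "circle_arc z0 r e1 e2 \<theta> = q0"
        by (rule exists_circle_arc[OF r sphere ne False])
      have "circle_arc z0 r e1 e2 t \<in> M" if "t \<in> {0..\<theta>}" for t
        using circle_arc_subset[OF M(2) r _ avoid on \<theta>(2) _ _ that] reach ends mem by simp
      from circle_arc_geodesic[OF r avoid on this \<theta>(1)] show ?thesis
        using reach by simp
    qed
  qed
qed

end
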